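(* Let $l\geq 1$ be an integer and $n\in\{2l,2l+1\}$. Let $B$ be the standard Borel subgroup of $\mathrm{O}_n=\mathrm{O}_n(\mathbf{C})$, acting by conjugation on the variety $\mathcal{N}(2)=\{x\in\mathfrak{o}_n\mid x^2=0\}$. Then the $B$-orbits in $\mathcal{N}(2)$ are in bijection with the set $\mathrm{Oolp}_l$ of orthogonal oriented link patterns of size $l$.
   Context: The ground field is $K=\mathbf{C}$. Let $J_n$ be the $n\times n$ anti-diagonal matrix with all anti-diagonal entries equal to $1$. Then $\mathrm{O}_n=\{A\in\mathrm{GL}_n(K)\mid A^TJ_nA=J_n\}$ with Lie algebra $\mathfrak{o}_n=\{a\in K^{n\times n}\mid a^TJ_n+J_na=0\}$. The standard Borel subgroup $B$ is the group of upper-triangular matrices in $\mathrm{O}_n$. An orthogonal oriented link pattern (oolp) of size $l$ consists of $l$ vertices $1,2,\dots,l$ together with a collection of oriented arrows between these vertices and a collection of oriented arrows with dots between these vertices, such that: (B) every vertex is touched by at most one arrow (dotted or not); (SpOr) there are no loops without dots (no undotted arrow from a vertex to itself); (Or) there are no loops with dots (no dotted arrow from a vertex to itself). $\mathrm{Oolp}_l$ denotes the set of oolps of size $l$. *)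

theory Defs
  imports Complex_Main "HOL-Algebra.Group_Action" "Jordan_Normal_Form.Matrix"
begin

section \<open>Orthogonal groups\<close>

text \<open>Rows and columns of a matrix are numbered from 0, so the anti-diagonal of an
  \<^term>\<open>n\<close> by \<^term>\<open>n\<close> matrix consists of the positions \<open>(i, j)\<close> with \<open>i + j = n - 1\<close>.\<close>

definition J_mat :: "nat \<Rightarrow> complex mat" where
  "J_mat n = mat n n (\<lambda>(i, j). if Suc (i + j) = n then 1 else 0)"

definition GL :: "nat \<Rightarrow> complex mat monoid" where
  "GL n = units_of (ring_mat TYPE(complex) n ())"

definition orthogonal_group :: "nat \<Rightarrow> complex mat monoid" where
  "orthogonal_group n =
     (GL n)\<lparr>carrier := {A \<in> carrier (GL n). transpose_mat A * J_mat n * A = J_mat n}\<rparr>"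

definition orthogonal_lie :: "nat \<Rightarrow> complex mat set" where
  "orthogonal_lie n =
     {a \<in> carrier_mat n n. transpose_mat a * J_mat n + J_mat n * a = 0\<^sub>m n n}"

definition borel_group :: "nat \<Rightarrow> complex mat monoid" where
  "borel_group n =
     (orthogonal_group n)\<lparr>carrier := {A \<in> carrier (orthogonal_group n). upper_triangular A}\<rparr>"

definition nilpotent2 :: "nat \<Rightarrow> complex mat set" where
  "nilpotent2 n = {x \<in> orthogonal_lie n. x ^\<^sub>m 2 = 0\<^sub>m n n}"

definition conjugation :: "nat \<Rightarrow> complex mat \<Rightarrow> complex mat \<Rightarrow> complex mat" where
  "conjugation n A = (\<lambda>x \<in> nilpotent2 n. A * x * inv\<^bsub>GL n\<^esub> A)"


section \<open>Orthogonal oriented link patterns\<close>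

datatype arrow = Arrow (dotted: bool) (source: nat) (target: nat)

definition touches :: "arrow \<Rightarrow> nat \<Rightarrow> bool" where
  "touches a v \<longleftrightarrow> source a = v \<or> target a = v"

text \<open>A collection of arrows is modelled as a set: two parallel copies of the same arrow
  are excluded anyway, since every vertex is touched by at most one arrow.\<close>

definition Oolp :: "nat \<Rightarrow> arrow set set" where
  "Oolp l = {P.
     (\<forall>a\<in>P. source a \<in> {1..l} \<and> target a \<in> {1..l}) \<and>
     (\<forall>v\<in>{1..l}. \<forall>a\<in>P. \<forall>b\<in>P. touches a v \<and> touches b v \<longrightarrow> a = b) \<and>
     (\<forall>a\<in>P. \<not> dotted a \<longrightarrow> source a \<noteq> target a) \<and>
     (\<forall>a\<in>P. dotted a \<longrightarrow> source a \<noteq> target a)}"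


section \<open>The Borel subgroup acts on the square-zero matrices\<close>

lemma J_mat_carrier [simp]: "J_mat n \<in> carrier_mat n n"
  by (simp add: J_mat_def)

lemma GL_simps [simp]: "monoid.mult (GL n) = (*)" "one (GL n) = 1\<^sub>m n"
  by (simp_all add: GL_def units_of_def ring_mat_def)

lemma group_GL: "group (GL n)"
proof -
  interpret R: ring "ring_mat TYPE(complex) n ()" by (rule ring_mat)
  show ?thesis unfolding GL_def by (rule R.units_group)
qed

lemma GL_carrierD: "A \<in> carrier (GL n) \<Longrightarrow> A \<in> carrier_mat n n"
  by (auto simp: GL_def units_of_def Units_def ring_mat_def)

lemma GL_inv:
  assumes "A \<in> carrier (GL n)"
  shows "inv\<^bsub>GL n\<^esub> A \<in> carrier (GL n)" "inv\<^bsub>GL n\<^esub> A \<in> carrier_mat n n"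
    "inv\<^bsub>GL n\<^esub> A * A = 1\<^sub>m n" "A * inv\<^bsub>GL n\<^esub> A = 1\<^sub>m n"
proof -
  interpret G: group "GL n" by (rule group_GL)
  show "inv\<^bsub>GL n\<^esub> A \<in> carrier (GL n)" using assms by simp
  then show "inv\<^bsub>GL n\<^esub> A \<in> carrier_mat n n" by (rule GL_carrierD)
  show "inv\<^bsub>GL n\<^esub> A * A = 1\<^sub>m n" "A * inv\<^bsub>GL n\<^esub> A = 1\<^sub>m n"
    using G.l_inv[OF assms] G.r_inv[OF assms] by simp_all
qed

lemma J_mat_mult_left:
  assumes "A \<in> carrier_mat n n" "i < n" "j < n"
  shows "(J_mat n * A) $$ (i, j) = A $$ (n - Suc i, j)"
proof -
  have "(J_mat n * A) $$ (i, j) = (\<Sum>k<n. J_mat n $$ (i, k) * A $$ (k, j))"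
    using assms by (simp add: J_mat_def scalar_prod_def atLeast0LessThan)
  also have "\<dots> = (\<Sum>k<n. (if k = n - Suc i then A $$ (k, j) else 0))"
    using assms by (intro sum.cong) (auto simp: J_mat_def)
  finally have "(J_mat n * A) $$ (i, j) = (\<Sum>k<n. (if k = n - Suc i then A $$ (k, j) else 0))" .
  then show ?thesis using assms by simp
qed

lemma J_mat_mult_right:
  assumes "A \<in> carrier_mat n n" "i < n" "j < n"
  shows "(A * J_mat n) $$ (i, j) = A $$ (i, n - Suc j)"
proof -
  have "(A * J_mat n) $$ (i, j) = (\<Sum>k<n. A $$ (i, k) * J_mat n $$ (k, j))"
    using assms by (simp add: J_mat_def scalar_prod_def atLeast0LessThan)
  also have "\<dots> = (\<Sum>k<n. (if k = n - Suc j then A $$ (i, k) else 0))"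
    using assms by (intro sum.cong) (auto simp: J_mat_def)
  finally have "(A * J_mat n) $$ (i, j) = (\<Sum>k<n. (if k = n - Suc j then A $$ (i, k) else 0))" .
  then show ?thesis using assms by simp
qed

lemma J_mat_square: "J_mat n * J_mat n = 1\<^sub>m n"
proof (rule eq_matI)
  fix i j assume "i < dim_row (1\<^sub>m n :: complex mat)" "j < dim_col (1\<^sub>m n :: complex mat)"
  then show "(J_mat n * J_mat n) $$ (i, j) = 1\<^sub>m n $$ (i, j)"
    by (subst J_mat_mult_left[OF J_mat_carrier]) (auto simp: J_mat_def)
qed (simp_all add: J_mat_def)

lemma orthogonal_inv:
  assumes "A \<in> carrier (orthogonal_group n)"
  shows "inv\<^bsub>GL n\<^esub> A = J_mat n * transpose_mat A * J_mat n"
proof -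
  have A: "A \<in> carrier (GL n)" and e: "transpose_mat A * J_mat n * A = J_mat n"
    using assms by (auto simp: orthogonal_group_def)
  note c = GL_carrierD[OF A] GL_inv(2)[OF A] J_mat_carrier
  have tc: "transpose_mat A \<in> carrier_mat n n" using c by simp
  let ?I = "inv\<^bsub>GL n\<^esub> A" and ?T = "transpose_mat A" and ?J = "J_mat n"
  have "?I = (?J * ?J) * ?I" using c by (simp add: J_mat_square)
  also have "\<dots> = ?J * (?J * ?I)" using c by (simp add: assoc_mult_mat[of _ n n _ n _ n])
  also have "?J * ?I = (?T * ?J * A) * ?I" by (simp add: e)
  also have "\<dots> = ?T * ?J * (A * ?I)"
    using c tc by (intro assoc_mult_mat[of _ n n _ n _ n] mult_carrier_mat)
  also have "\<dots> = ?T * ?J" using c tc GL_inv(4)[OF A]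
    by (simp add: right_mult_one_mat[of _ n n] mult_carrier_mat[of _ n n _ n])
  finally show ?thesis using c tc by (simp add: assoc_mult_mat[of _ n n _ n _ n])
qed

lemma subgroup_orthogonal: "subgroup (carrier (orthogonal_group n)) (GL n)"
proof -
  interpret G: group "GL n" by (rule group_GL)
  let ?J = "J_mat n"
  show ?thesis
  proof (rule G.subgroupI)
    show "carrier (orthogonal_group n) \<subseteq> carrier (GL n)" by (auto simp: orthogonal_group_def)
    have "1\<^sub>m n \<in> carrier (orthogonal_group n)"
      using G.one_closed by (auto simp: orthogonal_group_def transpose_one
          left_mult_one_mat[of _ n n] right_mult_one_mat[of _ n n])
    then show "carrier (orthogonal_group n) \<noteq> {}" by blast
  next
    fix A assume AO: "A \<in> carrier (orthogonal_group n)"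
    then have A: "A \<in> carrier (GL n)" and e: "transpose_mat A * ?J * A = ?J"
      by (auto simp: orthogonal_group_def)
    let ?I = "inv\<^bsub>GL n\<^esub> A"
    note c = GL_carrierD[OF A] GL_inv(2)[OF A] J_mat_carrier[of n]
    have tc: "transpose_mat A \<in> carrier_mat n n" "transpose_mat ?I \<in> carrier_mat n n"
      using c by simp_all
    have tt: "transpose_mat ?I * transpose_mat A = 1\<^sub>m n"
      using transpose_mult[OF c(1,2)] GL_inv(4)[OF A] by (simp add: transpose_one)
    have "transpose_mat ?I * ?J * ?I = transpose_mat ?I * (transpose_mat A * ?J * A) * ?I"
      by (simp add: e)
    also have "\<dots> = (transpose_mat ?I * transpose_mat A) * ?J * (A * ?I)"
      using c tc by (simp add: assoc_mult_mat[of _ n n _ n _ n] mult_carrier_mat[of _ n n _ n])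
    also have "\<dots> = ?J" using c tt GL_inv(4)[OF A]
      by (simp add: left_mult_one_mat[of _ n n] right_mult_one_mat[of _ n n])
    finally show "?I \<in> carrier (orthogonal_group n)"
      using GL_inv(1)[OF A] by (simp add: orthogonal_group_def)
  next
    fix A B assume "A \<in> carrier (orthogonal_group n)" "B \<in> carrier (orthogonal_group n)"
    then have A: "A \<in> carrier (GL n)" "transpose_mat A * ?J * A = ?J"
      and B: "B \<in> carrier (GL n)" "transpose_mat B * ?J * B = ?J"
      by (auto simp: orthogonal_group_def)
    note c = GL_carrierD[OF A(1)] GL_carrierD[OF B(1)] J_mat_carrier[of n]
    have tc: "transpose_mat A \<in> carrier_mat n n" "transpose_mat B \<in> carrier_mat n n"
      using c by simp_all
    have "transpose_mat (A * B) * ?J * (A * B) =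
        transpose_mat B * (transpose_mat A * ?J * A) * B"
      using c tc by (simp add: transpose_mult[OF c(1,2)] assoc_mult_mat[of _ n n _ n _ n]
          mult_carrier_mat[of _ n n _ n])
    also have "\<dots> = ?J" by (simp add: A B)
    finally show "A \<otimes>\<^bsub>GL n\<^esub> B \<in> carrier (orthogonal_group n)"
      using G.m_closed[OF A(1) B(1)] by (simp add: orthogonal_group_def)
  qed
qed

lemma subgroup_borel: "subgroup (carrier (borel_group n)) (GL n)"
proof -
  interpret G: group "GL n" by (rule group_GL)
  interpret O: subgroup "carrier (orthogonal_group n)" "GL n" by (rule subgroup_orthogonal)
  have iff: "A \<in> carrier (borel_group n) \<longleftrightarrow>
      A \<in> carrier (orthogonal_group n) \<and> upper_triangular A" for A
    by (simp add: borel_group_def)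
  show ?thesis
  proof (rule G.subgroupI)
    show "carrier (borel_group n) \<subseteq> carrier (GL n)" using O.subset by (auto simp: iff)
    have "1\<^sub>m n \<in> carrier (borel_group n)"
      using O.one_closed by (auto simp: iff upper_triangular_def)
    then show "carrier (borel_group n) \<noteq> {}" by blast
  next
    fix A assume "A \<in> carrier (borel_group n)"
    then have A: "A \<in> carrier (orthogonal_group n)" and u: "upper_triangular A"
      by (auto simp: iff)
    have c: "A \<in> carrier_mat n n" "transpose_mat A \<in> carrier_mat n n"
      using O.subset A GL_carrierD by auto
    have "upper_triangular (J_mat n * transpose_mat A * J_mat n)"
      unfolding upper_triangular_def
    proof (intro allI impI)
      fix i j assume "i < dim_row (J_mat n * transpose_mat A * J_mat n)" "j < i"
      then have "i < n" "j < i" by (simp_all add: J_mat_def)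
      then show "(J_mat n * transpose_mat A * J_mat n) $$ (i, j) = 0"
        using c u
        by (simp add: J_mat_mult_right[OF mult_carrier_mat[OF J_mat_carrier c(2)]]
            J_mat_mult_left[OF c(2)] upper_triangular_def)
    qed
    then show "inv\<^bsub>GL n\<^esub> A \<in> carrier (borel_group n)"
      using A by (simp add: iff O.m_inv_closed flip: orthogonal_inv)
  next
    fix A B assume "A \<in> carrier (borel_group n)" "B \<in> carrier (borel_group n)"
    then have A: "A \<in> carrier (orthogonal_group n)" "upper_triangular A"
      and B: "B \<in> carrier (orthogonal_group n)" "upper_triangular B"
      by (auto simp: iff)
    have c: "A \<in> carrier_mat n n" "B \<in> carrier_mat n n"
      using O.subset A B GL_carrierD by auto
    have "upper_triangular (A * B)"
      unfolding upper_triangular_def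
    proof (intro allI impI)
      fix i j assume "i < dim_row (A * B)" "j < i"
      then have ij: "i < n" "j < i" "j < n" using c by auto
      have "A $$ (i, k) * B $$ (k, j) = 0" if "k < n" for k
        using that ij A(2) B(2) c by (cases "k < i") (auto simp: upper_triangular_def)
      then show "(A * B) $$ (i, j) = 0"
        using c ij by (auto simp: scalar_prod_def intro!: sum.neutral)
    qed
    then show "A \<otimes>\<^bsub>GL n\<^esub> B \<in> carrier (borel_group n)"
      using A B O.m_closed by (auto simp: iff)
  qed
qed

lemma borel_group_eq: "borel_group n = (GL n)\<lparr>carrier := carrier (borel_group n)\<rparr>"
  by (simp add: borel_group_def orthogonal_group_def)

lemma conjugation_closed:
  assumes A: "A \<in> carrier (orthogonal_group n)" and x: "x \<in> nilpotent2 n"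
  shows "A * x * inv\<^bsub>GL n\<^esub> A \<in> nilpotent2 n"
proof -
  let ?I = "inv\<^bsub>GL n\<^esub> A" and ?J = "J_mat n" and ?T = "transpose_mat A"
    and ?S = "transpose_mat (inv\<^bsub>GL n\<^esub> A)"
  have AG: "A \<in> carrier (GL n)" and e: "?T * ?J * A = ?J"
    using A by (auto simp: orthogonal_group_def)
  have xc: "x \<in> carrier_mat n n" and x0: "transpose_mat x * ?J + ?J * x = 0\<^sub>m n n"
    and xx: "x * x = 0\<^sub>m n n"
    using x by (auto simp: nilpotent2_def orthogonal_lie_def numeral_2_eq_2)
  note c = GL_carrierD[OF AG] GL_inv(2)[OF AG] J_mat_carrier[of n] xc
  have tc: "?T \<in> carrier_mat n n" "?S \<in> carrier_mat n n" "transpose_mat x \<in> carrier_mat n n"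
    using c by simp_all
  note as = assoc_mult_mat[of _ n n _ n _ n] mult_carrier_mat[of _ n n _ n]
  have st: "?S * ?T = 1\<^sub>m n"
    using transpose_mult[OF c(1,2)] GL_inv(4)[OF AG] by (simp add: transpose_one)
  have JA: "?J * A = ?S * ?J"
  proof -
    have "?S * ?J = ?S * (?T * ?J * A)" by (simp add: e)
    also have "\<dots> = (?S * ?T) * (?J * A)" using c tc by (simp add: as)
    also have "\<dots> = ?J * A" using c
      by (simp add: st left_mult_one_mat[of _ n n] mult_carrier_mat[of _ n n _ n])
    finally show ?thesis by simp
  qed
  have TJ: "?T * ?J = ?J * ?I"
  proof -
    have "?J * ?I = (?T * ?J * A) * ?I" by (simp add: e)
    also have "\<dots> = ?T * ?J * (A * ?I)" using c tc by (simp add: as)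
    also have "\<dots> = ?T * ?J" using c tc
      by (simp add: GL_inv(4)[OF AG] right_mult_one_mat[of _ n n] mult_carrier_mat[of _ n n _ n])
    finally show ?thesis by simp
  qed
  have "transpose_mat (A * x * ?I) * ?J + ?J * (A * x * ?I)
      = ?S * transpose_mat x * (?T * ?J) + (?J * A) * x * ?I"
    using c tc by (simp add: transpose_mult[of _ n n _ n] as)
  also have "\<dots> = ?S * (transpose_mat x * ?J) * ?I + ?S * (?J * x) * ?I"
    using c tc by (simp add: TJ JA as)
  also have "\<dots> = ?S * (transpose_mat x * ?J + ?J * x) * ?I"
    using c tc by (simp add: add_mult_distrib_mat[of _ n n _ _ n]
        mult_add_distrib_mat[of _ n n _ n] mult_carrier_mat[of _ n n _ n])
  also have "\<dots> = 0\<^sub>m n n" using c tc by (simp add: x0)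
  finally have 1: "transpose_mat (A * x * ?I) * ?J + ?J * (A * x * ?I) = 0\<^sub>m n n" .
  have "(A * x * ?I) * (A * x * ?I) = A * x * ((?I * A) * (x * ?I))"
    using c by (simp add: as)
  also have "\<dots> = A * (x * x) * ?I" using c 
    by (simp add: GL_inv(3)[OF AG] as left_mult_one_mat[of _ n n])
  also have "\<dots> = 0\<^sub>m n n" using c by (simp add: xx)
  finally have 2: "(A * x * ?I) * (A * x * ?I) = 0\<^sub>m n n" .
  show ?thesis
    using 1 2 c by (simp add: nilpotent2_def orthogonal_lie_def numeral_2_eq_2
        mult_carrier_mat[of _ n n _ n])
qed

lemma group_action_borel: "group_action (borel_group n) (nilpotent2 n) (conjugation n)"
proof -
  interpret G: group "GL n" by (rule group_GL)
  interpret B: subgroup "carrier (borel_group n)" "GL n" by (rule subgroup_borel)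
  have grp: "group (borel_group n)"
    using G.subgroup_imp_group[OF subgroup_borel] borel_group_eq by metis
  have orth: "A \<in> carrier (orthogonal_group n)" if "A \<in> carrier (borel_group n)" for A
    using that by (simp add: borel_group_def)
  have ncar: "x \<in> carrier_mat n n" if "x \<in> nilpotent2 n" for x
    using that by (simp add: nilpotent2_def orthogonal_lie_def)
  note as = assoc_mult_mat[of _ n n _ n _ n] mult_carrier_mat[of _ n n _ n]
  have closed: "conjugation n A x \<in> nilpotent2 n"
    if "A \<in> carrier (borel_group n)" "x \<in> nilpotent2 n" for A x
    using conjugation_closed[OF orth] that by (simp add: conjugation_def)
  have comp: "conjugation n (A * C) x = conjugation n A (conjugation n C x)"
    if A: "A \<in> carrier (borel_group n)" and C: "C \<in> carrier (borel_group n)"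
      and x: "x \<in> nilpotent2 n" for A C x
  proof -
    have g: "A \<in> carrier (GL n)" "C \<in> carrier (GL n)" using A C B.subset by auto
    have i: "inv\<^bsub>GL n\<^esub> (A * C) = inv\<^bsub>GL n\<^esub> C * inv\<^bsub>GL n\<^esub> A"
      using G.inv_mult_group[OF g] by simp
    have y: "C * x * inv\<^bsub>GL n\<^esub> C \<in> nilpotent2 n" by (rule conjugation_closed[OF orth[OF C] x])
    show ?thesis
      using x y g[THEN GL_carrierD] g[THEN GL_inv(2)] ncar[OF x]
      by (simp add: conjugation_def i as)
  qed
  have one: "conjugation n (1\<^sub>m n) x = x" if "x \<in> nilpotent2 n" for x
    using that ncar[OF that] G.inv_one by (simp add: conjugation_def)
  have Bij: "conjugation n A \<in> Bij (nilpotent2 n)" if A: "A \<in> carrier (borel_group n)" for A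
  proof -
    have AG: "A \<in> carrier (GL n)" using A B.subset by auto
    have I: "inv\<^bsub>GL n\<^esub> A \<in> carrier (borel_group n)" using A by (rule B.m_inv_closed)
    have "bij_betw (conjugation n A) (nilpotent2 n) (nilpotent2 n)"
    proof (rule bij_betw_byWitness[where f' = "conjugation n (inv\<^bsub>GL n\<^esub> A)"])
      show "\<forall>x\<in>nilpotent2 n. conjugation n (inv\<^bsub>GL n\<^esub> A) (conjugation n A x) = x"
        using comp[OF I A] one GL_inv(3)[OF AG] by simp
      show "\<forall>x\<in>nilpotent2 n. conjugation n A (conjugation n (inv\<^bsub>GL n\<^esub> A) x) = x"
        using comp[OF A I] one GL_inv(4)[OF AG] by simp
    qed (use closed[OF A] closed[OF I] in auto)
    then show ?thesis by (simp add: Bij_def conjugation_def)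
  qed
  have hom: "conjugation n (A * C) = compose (nilpotent2 n) (conjugation n A) (conjugation n C)"
    if A: "A \<in> carrier (borel_group n)" and C: "C \<in> carrier (borel_group n)" for A C
  proof
    fix x
    show "conjugation n (A * C) x
        = compose (nilpotent2 n) (conjugation n A) (conjugation n C) x"
      using comp[OF A C] by (cases "x \<in> nilpotent2 n") (simp_all add: compose_def conjugation_def)
  qed
  have m: "monoid.mult (borel_group n) = (*)" by (subst borel_group_eq) simp
  show ?thesis
    unfolding group_action_def group_hom_def group_hom_axioms_def hom_def
    using grp group_BijGroup[of "nilpotent2 n"] Bij hom by (auto simp: BijGroup_def m)
qed

end

theory Submission
  imports Defs "Jordan_Normal_Form.Determinant"
begin

text \<open>Multiplying by \<open>J\<close> turns the action into \<open>y \<mapsto> C\<^sup>T y C\<close> on alternating forms \<open>y\<close> with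
  \<open>y J y = 0\<close>. Take the first nonzero row \<open>a\<close> of \<open>y\<close> and its first nonzero entry, in column \<open>p\<close>.
  Two Siegel transformations in \<open>B\<close> reduce the rows \<open>a\<close> and \<open>p\<close> to this single pivot, and
  \<open>y J y = 0\<close> then kills the rows of the opposite indices, so that induction applies to the
  remaining indices. Scaling by the torus makes \<open>y\<close> a signed matching of indices that never
  meets both \<open>i\<close> and its opposite. The matching is an invariant: if \<open>C\<^sup>T y C = z\<close> with \<open>y\<close> and
  \<open>z\<close> monomial and \<open>C\<close> triangular, then the supports of \<open>y\<close> and \<open>z\<close> agree. Such a matching
  pairs off vertices, with four choices of indices per pair, which correspond to the two
  orientations of a plain or dotted arrow.\<close>

section \<open>Congruence of isotropic alternating forms\<close>

definition cong_mat :: "complex mat \<Rightarrow> complex mat \<Rightarrow> complex mat" where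
  "cong_mat C y = transpose_mat C * y * C"

definition null_form :: "nat \<Rightarrow> complex mat \<Rightarrow> bool" where
  "null_form n y \<longleftrightarrow> y \<in> carrier_mat n n \<and> J_mat n * y \<in> nilpotent2 n"

text \<open>Only rows are restricted; for a null form skewness carries the condition over to
  columns.\<close>

definition monomial_rows :: "nat \<Rightarrow> complex mat \<Rightarrow> bool" where
  "monomial_rows n y \<longleftrightarrow>
     (\<forall>i<n. \<forall>j<n. \<forall>k<n. y $$ (i, j) \<noteq> 0 \<longrightarrow> y $$ (i, k) \<noteq> 0 \<longrightarrow> j = k)"

text \<open>\<open>C\<close> is the identity outside the block of \<open>T\<close>, so that
  reduction steps inside \<open>T\<close> leave pivots split off earlier untouched.\<close>

definition id_off :: "nat \<Rightarrow> nat set \<Rightarrow> complex mat \<Rightarrow> bool" where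
  "id_off n T C \<longleftrightarrow>
     (\<forall>i<n. \<forall>j<n. i \<notin> T \<or> j \<notin> T \<longrightarrow> C $$ (i, j) = (if i = j then 1 else 0))"

lemma mult_mat_index:
  assumes "A \<in> carrier_mat n n" "B \<in> carrier_mat n n" "i < n" "j < n"
  shows "(A * B) $$ (i, j) = (\<Sum>k<n. A $$ (i, k) * B $$ (k, j))"
  using assms by (simp add: scalar_prod_def atLeast0LessThan)

lemma cong_mat_carrier:
  assumes "C \<in> carrier_mat n n" "y \<in> carrier_mat n n"
  shows "cong_mat C y \<in> carrier_mat n n"
  using assms by (simp add: cong_mat_def)

text \<open>The inner sum is arranged first and the outer factor stands on the right, so that both
  sums have the shape "row times \<open>C\<close>" evaluated by \<open>siegel_sum\<close>.\<close>

lemma cong_mat_index: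
  assumes "C \<in> carrier_mat n n" "y \<in> carrier_mat n n" "i < n" "j < n"
  shows "cong_mat C y $$ (i, j) =
    (\<Sum>k<n. (\<Sum>m<n. y $$ (k, m) * C $$ (m, j)) * C $$ (k, i))"
proof -
  have t: "transpose_mat C \<in> carrier_mat n n" using assms by simp
  have "cong_mat C y = transpose_mat C * (y * C)"
    unfolding cong_mat_def using assms t by (intro assoc_mult_mat)
  then have "cong_mat C y $$ (i, j) = (\<Sum>k<n. transpose_mat C $$ (i, k) * (y * C) $$ (k, j))"
    using mult_mat_index[OF t mult_carrier_mat[OF assms(2,1)] assms(3,4)] by simp
  also have "\<dots> = (\<Sum>k<n. (\<Sum>m<n. y $$ (k, m) * C $$ (m, j)) * C $$ (k, i))"
    using assms by (intro sum.cong) (auto simp: mult_mat_index simp del: index_mult_mat)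
  finally show ?thesis .
qed

lemma cong_mat_mult:
  assumes "C \<in> carrier_mat n n" "D \<in> carrier_mat n n" "y \<in> carrier_mat n n"
  shows "cong_mat (C * D) y = cong_mat D (cong_mat C y)"
  using assms
  by (simp add: cong_mat_def transpose_mult[of _ n n _ n] assoc_mult_mat[of _ n n _ n _ n]
      mult_carrier_mat[of _ n n _ n])

section \<open>Membership in the Borel subgroup and its action on forms\<close>

lemma borel_carrierD:
  assumes "C \<in> carrier (borel_group n)"
  shows "C \<in> carrier_mat n n" "C \<in> carrier (GL n)" "C \<in> carrier (orthogonal_group n)"
    "upper_triangular C"
  using assms GL_carrierD by (auto simp: borel_group_def orthogonal_group_def)

lemma borel_mult:
  assumes "C \<in> carrier (borel_group n)" "D \<in> carrier (borel_group n)"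
  shows "C * D \<in> carrier (borel_group n)"
  using subgroup.m_closed[OF subgroup_borel assms] by simp

lemma borel_inv:
  assumes "C \<in> carrier (borel_group n)"
  shows "inv\<^bsub>GL n\<^esub> C \<in> carrier (borel_group n)"
  using subgroup.m_inv_closed[OF subgroup_borel assms] .

text \<open>Multiplying \<open>e\<close> by \<open>J_mat n\<close> exhibits \<open>J C^T J\<close>
  as a left inverse of \<open>C\<close>, and a left inverse of a square matrix is two-sided.\<close>

lemma borelI:
  assumes C: "C \<in> carrier_mat n n" and u: "upper_triangular C"
    and e: "transpose_mat C * J_mat n * C = J_mat n"
  shows "C \<in> carrier (borel_group n)"
proof -
  let ?D = "J_mat n * (transpose_mat C * J_mat n)"
  have D: "?D \<in> carrier_mat n n" using C by (simp add: mult_carrier_mat[of _ n n _ n])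
  have "?D * C = J_mat n * (transpose_mat C * J_mat n * C)"
    using C by (intro assoc_mult_mat[of _ n n _ n _ n]) (simp_all add: mult_carrier_mat[of _ n n _ n])
  then have l: "?D * C = 1\<^sub>m n" by (simp add: e J_mat_square)
  have r: "C * ?D = 1\<^sub>m n" by (rule mat_mult_left_right_inverse[OF D C l])
  have "C \<in> carrier (GL n)"
    unfolding GL_def units_of_def Units_def ring_mat_def using C D l r by auto
  then show ?thesis using u e by (simp add: borel_group_def orthogonal_group_def)
qed

text \<open>Orthogonality gives the inverse as \<open>J C^T J\<close>, and \<open>J\<close> squares
  to 1; so congruence of \<open>y\<close> by \<open>C\<close> is conjugation of \<open>J y\<close>
  by the inverse of \<open>C\<close>.\<close>

lemma J_conj:
  assumes C: "C \<in> carrier (orthogonal_group n)" and y: "y \<in> carrier_mat n n"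
  shows "J_mat n * cong_mat C y = inv\<^bsub>GL n\<^esub> C * (J_mat n * y) * C"
proof -
  have c: "C \<in> carrier_mat n n" "transpose_mat C \<in> carrier_mat n n"
    using C GL_carrierD by (auto simp: orthogonal_group_def)
  have "inv\<^bsub>GL n\<^esub> C * (J_mat n * y) * C =
     J_mat n * (transpose_mat C * ((J_mat n * J_mat n) * y * C))"
    using c y by (simp add: orthogonal_inv[OF C] assoc_mult_mat[of _ n n _ n _ n]
        mult_carrier_mat[of _ n n _ n])
  also have "\<dots> = J_mat n * cong_mat C y"
    using c y by (simp add: J_mat_square cong_mat_def assoc_mult_mat[of _ n n _ n _ n]
        mult_carrier_mat[of _ n n _ n])
  finally show ?thesis by simp
qed

lemma null_form_carrier: "null_form n y \<Longrightarrow> y \<in> carrier_mat n n"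
  by (simp add: null_form_def)

lemma GL_inv_inv:
  assumes "C \<in> carrier (GL n)" shows "inv\<^bsub>GL n\<^esub> (inv\<^bsub>GL n\<^esub> C) = C"
proof -
  interpret G: group "GL n" by (rule group_GL)
  show ?thesis using assms by simp
qed

lemma null_form_cong:
  assumes C: "C \<in> carrier (borel_group n)" and y: "null_form n y"
  shows "null_form n (cong_mat C y)"
proof -
  have yc: "y \<in> carrier_mat n n" "J_mat n * y \<in> nilpotent2 n" using y by (auto simp: null_form_def)
  have "inv\<^bsub>GL n\<^esub> C * (J_mat n * y) * inv\<^bsub>GL n\<^esub> (inv\<^bsub>GL n\<^esub> C) \<in> nilpotent2 n"
    using borel_carrierD[OF borel_inv[OF C]] yc by (intro conjugation_closed)
  then show ?thesis
    using C yc borel_carrierD[OF C]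
    by (simp add: null_form_def J_conj GL_inv_inv cong_mat_carrier)
qed

lemma J_mat_mult_cancel:
  assumes "y \<in> carrier_mat n n"
  shows "J_mat n * (J_mat n * y) = y"
  using assms by (simp add: J_mat_square assoc_mult_mat[of _ n n _ n _ n, symmetric])

text \<open>\<open>J\<close> is symmetric with square 1. Hence the transpose of \<open>J y\<close>
  times \<open>J\<close> is the transpose of \<open>y\<close>, and the Lie algebra condition becomes
  skewness. The square of \<open>J y\<close> is \<open>J (y J y)\<close>, where the left
  \<open>J\<close> cancels; the sums are the entries of \<open>y J y\<close>.\<close>

lemma null_form_iff:
  "null_form n y \<longleftrightarrow> y \<in> carrier_mat n n \<and> (\<forall>i<n. \<forall>j<n. y $$ (i, j) = - y $$ (j, i)) \<and>
     (\<forall>i<n. \<forall>j<n. (\<Sum>k<n. y $$ (i, k) * y $$ (n - Suc k, j)) = 0)"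
  (is "_ \<longleftrightarrow> _ \<and> ?skew \<and> ?null")
proof (cases "y \<in> carrier_mat n n")
  case y: True
  let ?J = "J_mat n"
  have Jy: "?J * y \<in> carrier_mat n n" using y by (simp add: mult_carrier_mat[of _ n n _ n])
  have "transpose_mat ?J = ?J" by (rule eq_matI) (auto simp: J_mat_def add.commute)
  then have "transpose_mat (?J * y) * ?J = transpose_mat y"
    using y by (simp add: transpose_mult[of _ n n _ n] J_mat_square
        assoc_mult_mat[of _ n n _ n _ n])
  moreover have "transpose_mat y + y = 0\<^sub>m n n \<longleftrightarrow> ?skew"
  proof -
    have "transpose_mat y + y = 0\<^sub>m n n \<longleftrightarrow> (\<forall>i<n. \<forall>j<n. y $$ (j, i) + y $$ (i, j) = 0)"
      using y by (auto simp: mat_eq_iff)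
    then show ?thesis by (simp add: add_eq_0_iff)
  qed
  ultimately have 1: "?J * y \<in> orthogonal_lie n \<longleftrightarrow> ?skew"
    using Jy y by (simp add: orthogonal_lie_def J_mat_mult_cancel)
  have sq: "(?J * y) ^\<^sub>m 2 = ?J * (y * (?J * y))"
    using y Jy by (simp add: numeral_2_eq_2 assoc_mult_mat[of _ n n _ n _ n])
  have zero: "?J * (y * (?J * y)) = 0\<^sub>m n n \<longleftrightarrow> y * (?J * y) = 0\<^sub>m n n"
    using J_mat_mult_cancel[of "y * (?J * y)" n] y Jy by (metis J_mat_carrier mult_carrier_mat right_mult_zero_mat)
  have null: "y * (?J * y) = 0\<^sub>m n n \<longleftrightarrow> ?null"
  proof -
    have "(y * (?J * y)) $$ (i, j) = (\<Sum>k<n. y $$ (i, k) * y $$ (n - Suc k, j))"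
      if "i < n" "j < n" for i j
      using that by (simp add: mult_mat_index[OF y Jy] J_mat_mult_left[OF y] del: index_mult_mat)
    moreover have "y * (?J * y) \<in> carrier_mat n n" using y Jy by simp
    ultimately show ?thesis by (auto simp: mat_eq_iff simp del: index_mult_mat(1))
  qed
  have "(?J * y) ^\<^sub>m 2 = 0\<^sub>m n n \<longleftrightarrow> ?null"
    unfolding sq zero by (rule null)
  then show ?thesis using y 1 by (simp add: null_form_def nilpotent2_def)
qed (simp add: null_form_def)

lemma null_form_skew:
  "null_form n y \<Longrightarrow> i < n \<Longrightarrow> j < n \<Longrightarrow> y $$ (i, j) = - y $$ (j, i)"
  unfolding null_form_iff by blast

lemma null_form_sum:
  "null_form n y \<Longrightarrow> i < n \<Longrightarrow> j < n \<Longrightarrow> (\<Sum>k<n. y $$ (i, k) * y $$ (n - Suc k, j)) = 0"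
  unfolding null_form_iff by blast

section \<open>Matrices that differ from the identity in one block only\<close>

lemma id_off_mult:
  assumes C: "C \<in> carrier_mat n n" "id_off n T C" and D: "D \<in> carrier_mat n n" "id_off n T D"
  shows "id_off n T (C * D)"
  unfolding id_off_def
proof (intro allI impI)
  fix i j assume ij: "i < n" "j < n" "i \<notin> T \<or> j \<notin> T"
  have "C $$ (i, k) * D $$ (k, j) = (if k = i then if i = j then 1 else 0 else 0)" if "k < n" for k
    using ij that C(2) D(2) unfolding id_off_def by (cases "i \<in> T"; cases "j \<in> T"; cases "k \<in> T") auto
  then show "(C * D) $$ (i, j) = (if i = j then 1 else 0)"
    using C D ij by (simp add: mult_mat_index del: index_mult_mat)
qed

lemma id_off_mono: "id_off n S C \<Longrightarrow> S \<subseteq> T \<Longrightarrow> id_off n T C"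
  unfolding id_off_def by blast

section \<open>Siegel transformations\<close>

text \<open>The Siegel transformation
  \<open>v \<mapsto> v + \<langle>v, e\<rangle> w - \<langle>v, w\<rangle> e - 1/2 \<langle>w, w\<rangle> \<langle>v, e\<rangle> e\<close> for the isotropic vector \<open>e = e\<^sub>p\<close>
  and a vector \<open>w\<close> orthogonal to it; it covers the root elements of both parities of \<open>n\<close>
  uniformly.\<close>

definition siegel :: "nat \<Rightarrow> nat \<Rightarrow> (nat \<Rightarrow> complex) \<Rightarrow> complex mat" where
  "siegel n p w = mat n n (\<lambda>(i, j).
     (if i = j then 1 else 0) + (if j = n - Suc p then w i else 0)
     - (if i = p then w (n - Suc j) else 0)
     - (if i = p \<and> j = n - Suc p then (\<Sum>k<n. w k * w (n - Suc k)) / 2 else 0))"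

lemma siegel_carrier: "siegel n p w \<in> carrier_mat n n"
  by (simp add: siegel_def)

text \<open>Outside the column opposite to \<open>p\<close>, the row \<open>f\<close> changes only
  by multiples of its entry at \<open>p\<close>; this is how a pivot at \<open>p\<close> clears the
  rest of its row.\<close>

lemma siegel_sum:
  assumes "p < n" "j < n"
  shows "(\<Sum>k<n. f k * siegel n p w $$ (k, j)) = f j - f p * w (n - Suc j)
     + (if j = n - Suc p then (\<Sum>k<n. f k * w k) - f p * ((\<Sum>k<n. w k * w (n - Suc k)) / 2) else 0)"
proof -
  let ?q = "(\<Sum>k<n. w k * w (n - Suc k)) / 2"
  have "(\<Sum>k<n. f k * siegel n p w $$ (k, j)) = (\<Sum>k<n. (if k = j then f k else 0)
      + (if j = n - Suc p then f k * w k else 0) - (if k = p then f k * w (n - Suc j) else 0)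
      - (if k = p then if j = n - Suc p then f k * ?q else 0 else 0))"
    using assms by (intro sum.cong) (auto simp: siegel_def algebra_simps)
  also have "\<dots> = f j + (if j = n - Suc p then (\<Sum>k<n. f k * w k) else 0) - f p * w (n - Suc j)
      - (if j = n - Suc p then f p * ?q else 0)"
    using assms by (cases "j = n - Suc p") (simp_all add: sum.distrib sum_subtractf)
  finally show ?thesis by simp
qed

lemma sum_reflect: "(\<Sum>k<n. f (n - Suc k)) = (\<Sum>k<n. f k :: complex)" for f :: "nat \<Rightarrow> complex"
  by (rule sum.nat_diff_reindex)

lemma J_form_index:
  assumes "C \<in> carrier_mat n n" "i < n" "j < n"
  shows "(transpose_mat C * J_mat n * C) $$ (i, j) = (\<Sum>k<n. C $$ (n - Suc k, j) * C $$ (k, i))"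
proof -
  have "(\<Sum>m<n. J_mat n $$ (k, m) * C $$ (m, j)) = C $$ (n - Suc k, j)" if "k < n" for k
    using mult_mat_index[OF J_mat_carrier assms(1) that assms(3)] J_mat_mult_left[OF assms(1) that assms(3)]
    by simp
  then show ?thesis
    using cong_mat_index[OF assms(1) J_mat_carrier assms(2,3)] by (simp add: cong_mat_def)
qed

text \<open>The strict bound on the support makes \<open>w\<close> orthogonal to the isotropic
  vector \<open>e_p\<close>, so the transformation is an isometry. The same bound puts the new
  entries of column \<open>n - Suc p\<close> above the diagonal and those of row \<open>p\<close> to
  the right of it.\<close>

lemma siegel_borel:
  assumes p: "p < n" "p \<noteq> n - Suc p"
    and w: "w p = 0" "\<And>k. k < n \<Longrightarrow> w k \<noteq> 0 \<Longrightarrow> k < n - Suc p"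
  shows "siegel n p w \<in> carrier (borel_group n)"
proof (rule borelI[OF siegel_carrier])
  let ?q = "\<Sum>k<n. w k * w (n - Suc k)"
  have wp: "w (n - Suc p) = 0" using w(2)[of "n - Suc p"] p by auto
  \<comment> \<open>Only in this case does the quadratic term at \<open>(p, n - Suc p)\<close> lie
    below the diagonal; an index and its opposite then cannot both be smaller than
    \<open>n - Suc p\<close>.\<close>
  have q0: "?q = 0" if "n - Suc p < p"
  proof (rule sum.neutral, safe)
    fix k assume "k < n"
    then show "w k * w (n - Suc k) = 0"
      using w(2)[of k] w(2)[of "n - Suc k"] that by (cases "w k = 0"; cases "w (n - Suc k) = 0") auto
  qed
  show "upper_triangular (siegel n p w)"
    unfolding upper_triangular_def
  proof (intro allI impI)
    fix i j assume "i < dim_row (siegel n p w)" and ji: "j < i"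
    then have i: "i < n" by (simp add: siegel_def)
    have "w i = 0" if "j = n - Suc p" using w(2)[OF i] ji that by auto
    moreover have "w (n - Suc j) = 0" if "i = p"
      using w(2)[of "n - Suc j"] ji i that by (cases "w (n - Suc j) = 0") auto
    ultimately show "siegel n p w $$ (i, j) = 0"
      using i ji q0 by (simp add: siegel_def)
  qed
  show "transpose_mat (siegel n p w) * J_mat n * siegel n p w = J_mat n"
  proof (rule eq_matI)
    fix i j assume "i < dim_row (J_mat n)" "j < dim_col (J_mat n)"
    then have ij: "i < n" "j < n" by (simp_all add: J_mat_def)
    let ?S = "siegel n p w"
    have e: "?S $$ (n - Suc k, j) = (if n - Suc k = j then 1 else 0)
        + (if j = n - Suc p then w (n - Suc k) else 0) - (if n - Suc k = p then w (n - Suc j) else 0)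
        - (if n - Suc k = p \<and> j = n - Suc p then ?q / 2 else 0)" if "k < n" for k
      using that ij by (simp add: siegel_def)
    \<comment> \<open>Reflecting the index turns the sum into a row times the matrix, which
      \<open>siegel_sum\<close> evaluates.\<close>
    have "(\<Sum>k<n. ?S $$ (n - Suc k, j) * w k) = (\<Sum>k<n. w (n - Suc k) * ?S $$ (k, j))"
      by (subst sum_reflect[symmetric]) (intro sum.cong, auto)
    also have "\<dots> = w (n - Suc j) + (if j = n - Suc p then ?q else 0)"
      using p ij wp w(1) by (simp add: siegel_sum) (simp add: mult.commute)
    finally have s: "(\<Sum>k<n. ?S $$ (n - Suc k, j) * w k) = w (n - Suc j) + (if j = n - Suc p then ?q else 0)" .
    have ep: "?S $$ (n - Suc p, j) = (if j = n - Suc p then 1 else 0)"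
      using p ij wp by (auto simp: e)
    have x: "n - Suc i = j \<longleftrightarrow> Suc (i + j) = n" "n - Suc i = p \<longleftrightarrow> i = n - Suc p" using ij p by auto
    have "(transpose_mat ?S * J_mat n * ?S) $$ (i, j) = (\<Sum>k<n. ?S $$ (n - Suc k, j) * ?S $$ (k, i))"
      using ij by (intro J_form_index siegel_carrier)
    also have "\<dots> = J_mat n $$ (i, j)"
      unfolding siegel_sum[OF p(1) ij(1)] s ep using ij
      by (simp add: e x) (simp add: J_mat_def)
    finally show "(transpose_mat ?S * J_mat n * ?S) $$ (i, j) = J_mat n $$ (i, j)" .
  qed (simp_all add: siegel_def J_mat_def)
qed

lemma siegel_id_off:
  assumes "p \<in> T" "T \<subseteq> {..<n}" "\<And>i. i \<in> T \<Longrightarrow> n - Suc i \<in> T" "\<And>k. k < n \<Longrightarrow> k \<notin> T \<Longrightarrow> w k = 0"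
  shows "id_off n T (siegel n p w)"
  unfolding id_off_def
proof (intro allI impI)
  fix i j assume ij: "i < n" "j < n" "i \<notin> T \<or> j \<notin> T"
  have "n - Suc (n - Suc j) = j" using ij by simp
  then have "n - Suc j \<notin> T" if "j \<notin> T" using assms(3)[of "n - Suc j"] that by auto
  then have "w (n - Suc j) = 0" if "j \<notin> T" using that assms(4)[of "n - Suc j"] ij by auto
  moreover have "n - Suc p \<in> T" using assms by simp
  ultimately show "siegel n p w $$ (i, j) = (if i = j then 1 else 0)"
    using ij assms by (auto simp: siegel_def)
qed

section \<open>Isotropic vectors and the rows of null forms\<close>

lemma isotropic_leading:
  fixes f :: "nat \<Rightarrow> complex"
  assumes "(\<Sum>k<n. f k * f (n - Suc k)) = 0" "p < n" "\<And>k. k < p \<Longrightarrow> f k = 0" "f p \<noteq> 0"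
  shows "p \<noteq> n - Suc p"
proof
  assume pp: "p = n - Suc p"
  \<comment> \<open>If \<open>p\<close> is the middle index, any other \<open>k\<close> has itself
    or its opposite below \<open>p\<close>, where \<open>f\<close> vanishes; only the square of
    \<open>f p\<close> survives.\<close>
  have "(\<Sum>k<n. f k * f (n - Suc k)) = (\<Sum>k<n. if k = p then f p * f p else 0)"
  proof (rule sum.cong)
    fix k assume "k \<in> {..<n}"
    then have "k < p \<or> k = p \<or> n - Suc k < p" using pp by auto
    then show "f k * f (n - Suc k) = (if k = p then f p * f p else 0)"
      using assms(3)[of k] assms(3)[of "n - Suc k"] pp by auto
  qed simp
  then show False using assms by simp
qed

text \<open>The isotropy sum collapses to twice the product of the two opposite entries.\<close>

lemma isotropic_two_terms:
  fixes f :: "nat \<Rightarrow> complex"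
  assumes "(\<Sum>k<n. f k * f (n - Suc k)) = 0" "p < n" "p \<noteq> n - Suc p" "f p \<noteq> 0"
    "\<And>k. k < n \<Longrightarrow> k \<noteq> p \<Longrightarrow> k \<noteq> n - Suc p \<Longrightarrow> f k = 0"
  shows "f (n - Suc p) = 0"
proof -
  have "(\<Sum>k<n. f k * f (n - Suc k)) = (\<Sum>k<n. (if k = p then f p * f (n - Suc p) else 0)
      + (if k = n - Suc p then f p * f (n - Suc p) else 0))"
    using assms by (intro sum.cong) auto
  also have "\<dots> = 2 * (f p * f (n - Suc p))"
    using assms(2) by (simp add: sum.distrib)
  finally show ?thesis using assms by simp
qed

text \<open>By skewness this is minus the diagonal entry of \<open>y J y\<close>: every row is an
  isotropic vector.\<close>

lemma null_form_row:
  assumes "null_form n y" "i < n"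
  shows "(\<Sum>k<n. y $$ (i, k) * y $$ (i, n - Suc k)) = 0"
proof -
  have "(\<Sum>k<n. y $$ (i, k) * y $$ (i, n - Suc k)) = - (\<Sum>k<n. y $$ (i, k) * y $$ (n - Suc k, i))"
    unfolding sum_negf[symmetric] using assms
    by (intro sum.cong refl) (subst null_form_skew[of n y i], auto)
  then show ?thesis using null_form_sum[OF assms(1,2,2)] by simp
qed

text \<open>When row \<open>i\<close> has a single entry, in column \<open>j\<close>, the entry
  \<open>(i, m)\<close> of \<open>y J y\<close> is that entry times
  \<open>y $$ (n - Suc j, m)\<close>.\<close>

lemma null_form_opposite_row:
  assumes y: "null_form n y" and "i < n" "j < n" "m < n" "y $$ (i, j) \<noteq> 0"
    and "\<And>k. k < n \<Longrightarrow> k \<noteq> j \<Longrightarrow> y $$ (i, k) = 0"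
  shows "y $$ (n - Suc j, m) = 0"
proof -
  have "(\<Sum>k<n. y $$ (i, k) * y $$ (n - Suc k, m)) = (\<Sum>k<n. if k = j then y $$ (i, j) * y $$ (n - Suc j, m) else 0)"
    using assms by (intro sum.cong) auto
  then show ?thesis using null_form_sum[OF y, of i m] assms by simp
qed

lemma cong_mat_siegel:
  assumes "y \<in> carrier_mat n n" "p < n" "i < n" "j < n" "i \<noteq> n - Suc p"
  shows "cong_mat (siegel n p w) y $$ (i, j) =
    (\<Sum>m<n. y $$ (i, m) * siegel n p w $$ (m, j))
    - w (n - Suc i) * (\<Sum>m<n. y $$ (p, m) * siegel n p w $$ (m, j))"
  using assms by (simp add: cong_mat_index[OF siegel_carrier] siegel_sum[of p n i])

text \<open>For triangular \<open>C\<close>, row \<open>i\<close> of the result combines only rows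
  \<open>k \<le> i\<close> of \<open>y\<close>.\<close>

lemma cong_mat_leading_rows:
  assumes C: "C \<in> carrier_mat n n" "upper_triangular C" and y: "y \<in> carrier_mat n n"
    and "i < n" "j < n" and z: "\<And>k m. k \<le> i \<Longrightarrow> m < n \<Longrightarrow> y $$ (k, m) = 0"
  shows "cong_mat C y $$ (i, j) = 0"
proof -
  have "(\<Sum>m<n. y $$ (k, m) * C $$ (m, j)) * C $$ (k, i) = 0" if "k < n" for k
    using that C z assms(4) by (cases "k \<le> i") (auto simp: upper_triangular_def)
  then show ?thesis using assms by (simp add: cong_mat_index sum.neutral)
qed

section \<open>Reduction to a monomial form\<close>

text \<open>Minimality does half of the clearing: row \<open>a\<close> vanishes left of
  \<open>p\<close> and, by skewness, row \<open>p\<close> vanishes left of \<open>a\<close>. Each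
  row has to be cleared only to the right of its pivot, which is within reach of upper triangular
  matrices.\<close>

lemma pivot_reduction:
  assumes T: "T \<subseteq> {..<n}" "\<And>i. i \<in> T \<Longrightarrow> n - Suc i \<in> T"
    and y: "null_form n y" "\<And>i j. i < n \<Longrightarrow> j < n \<Longrightarrow> y $$ (i, j) \<noteq> 0 \<Longrightarrow> i \<in> T"
    and ap: "a < n" "p < n" "y $$ (a, p) \<noteq> 0"
    and a_least: "\<And>i j. i < a \<Longrightarrow> j < n \<Longrightarrow> y $$ (i, j) = 0"
    and p_least: "\<And>j. j < p \<Longrightarrow> y $$ (a, j) = 0"
  shows "\<exists>C\<in>carrier (borel_group n). id_off n T C \<and>
    (\<forall>j<n. cong_mat C y $$ (a, j) \<noteq> 0 \<longleftrightarrow> j = p) \<and>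
    (\<forall>j<n. cong_mat C y $$ (p, j) \<noteq> 0 \<longleftrightarrow> j = a)"
proof -
  have yc: "y \<in> carrier_mat n n" using y(1) by (rule null_form_carrier)
  have skew: "y $$ (i, j) = - y $$ (j, i)" if "i < n" "j < n" for i j
    using null_form_skew[OF y(1) that] .
  have diag: "y $$ (i, i) = 0" if "i < n" for i using skew[OF that that] by simp
  have supp: "y $$ (i, j) = 0" if "i < n" "j < n" "i \<notin> T \<or> j \<notin> T" for i j
    using y(2)[of i j] y(2)[of j i] skew[of i j] that by auto
  have aT: "a \<in> T" "p \<in> T" using supp[of a p] ap by auto
  have "a \<le> p" using a_least[of p a] skew[of a p] ap by force
  then have a_less: "a < p" using diag[of a] ap by (cases "a = p") auto
  have pp: "p \<noteq> n - Suc p"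
    using isotropic_leading[OF null_form_row[OF y(1) ap(1)] ap(2)] p_least ap by auto
  have aa: "a \<noteq> n - Suc a"
  proof (rule isotropic_leading[OF null_form_row[OF y(1) ap(2)] ap(1)])
    show "y $$ (p, k) = 0" if "k < a" for k using a_least[OF that ap(2)] skew[of p k] that ap by simp
    show "y $$ (p, a) \<noteq> 0" using skew[of p a] ap by simp
  qed
  \<comment> \<open>Were \<open>p\<close> opposite to \<open>a\<close>, the entry
    \<open>(a, p)\<close> of \<open>y J y\<close> would reduce to the square of the pivot: terms
    before \<open>p\<close> vanish by the choice of \<open>p\<close>, terms after it involve rows
    above \<open>a\<close>.\<close>
  have pa: "p \<noteq> n - Suc a"
  proof
    assume e: "p = n - Suc a"
    have "(\<Sum>k<n. y $$ (a, k) * y $$ (n - Suc k, p)) =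
        (\<Sum>k<n. if k = p then y $$ (a, p) * y $$ (a, p) else 0)"
    proof (rule sum.cong)
      fix k assume k: "k \<in> {..<n}"
      have "n - Suc k < a" if "k > p" using that e ap k by auto
      then show "y $$ (a, k) * y $$ (n - Suc k, p) = (if k = p then y $$ (a, p) * y $$ (a, p) else 0)"
        using p_least[of k] a_least[of "n - Suc k" p] e ap k
        by (cases k p rule: linorder_cases) auto
    qed simp
    then show False using null_form_sum[OF y(1) ap(1,2)] ap by simp
  qed
  \<comment> \<open>\<open>C\<close> clears row \<open>a\<close> up to the pivot, then \<open>D\<close> clears row \<open>p\<close>. The entries that Siegel
    transformations cannot reach, in the columns opposite to the pivots, vanish because the rows
    are isotropic.\<close>
  define v where "v k = (if k < n - Suc p \<and> k \<noteq> p then y $$ (a, n - Suc k) / y $$ (a, p) else 0)" for k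
  define C where "C = siegel n p v"
  define z where "z = cong_mat C y"
  have C: "C \<in> carrier (borel_group n)" unfolding C_def
    using ap pp by (intro siegel_borel) (auto simp: v_def split: if_splits)
  have CT: "id_off n T C" unfolding C_def
  proof (rule siegel_id_off[OF aT(2) T])
    fix k assume k: "k < n" "k \<notin> T"
    then have "n - Suc (n - Suc k) \<notin> T" by simp
    then have "n - Suc k \<notin> T" using T(2) by metis
    then show "v k = 0" using supp[of a "n - Suc k"] ap k by (simp add: v_def)
  qed
  have z: "null_form n z" unfolding z_def using C y(1) by (rule null_form_cong)
  have zc: "z \<in> carrier_mat n n" using z by (rule null_form_carrier)
  have zskew: "z $$ (i, j) = - z $$ (j, i)" if "i < n" "j < n" for i j
    using null_form_skew[OF z that] .
  have zdiag: "z $$ (i, i) = 0" if "i < n" for i using zskew[OF that that] by simp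
  \<comment> \<open>A multiple of the diagonal entry \<open>y $$ (a, a)\<close>; because it
    vanishes, the left factor of the congruence does not change row \<open>a\<close>.\<close>
  have va: "v (n - Suc a) = 0" using diag[of a] ap by (simp add: v_def)
  have z_row: "z $$ (a, j) = (if j = p then y $$ (a, p) else 0)" if j: "j < n" "j \<noteq> n - Suc p" for j
  proof -
    have "z $$ (a, j) = (\<Sum>m<n. y $$ (a, m) * C $$ (m, j))"
      unfolding z_def C_def using ap j pa va by (subst cong_mat_siegel[OF yc]) auto
    also have "\<dots> = y $$ (a, j) - y $$ (a, p) * v (n - Suc j)"
      unfolding C_def using ap j by (simp add: siegel_sum)
    \<comment> \<open>The columns \<open>j > p\<close> are those with
      \<open>n - Suc j < n - Suc p\<close>, so the cutoff in \<open>v\<close> that keeps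
      \<open>C\<close> triangular costs nothing: the columns it skips on the left of
      \<open>p\<close> are zero already.\<close>
    also have "\<dots> = (if j = p then y $$ (a, p) else 0)"
    proof (cases j p rule: linorder_cases)
      case less
      then show ?thesis using p_least[OF less] ap by (auto simp: v_def)
    next
      case equal
      then show ?thesis using pp by (auto simp: v_def)
    next
      case greater
      then have "n - Suc j < n - Suc p" "n - Suc j \<noteq> p" using j ap by auto
      then show ?thesis using greater j ap by (simp add: v_def)
    qed
    finally show ?thesis .
  qed
  have z_row': "z $$ (a, j) = (if j = p then y $$ (a, p) else 0)" if j: "j < n" for j
  proof (cases "j = n - Suc p")
    case True
    have "z $$ (a, n - Suc p) = 0"
      by (rule isotropic_two_terms[OF null_form_row[OF z ap(1)] ap(2) pp]) (use z_row ap pp in auto)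
    then show ?thesis using True pp by simp
  qed (use z_row j in simp)
  have z_opp: "z $$ (n - Suc p, m) = 0" if "m < n" for m
    by (rule null_form_opposite_row[OF z ap(1,2) that]) (use z_row' ap in auto)
  have z_opp': "z $$ (m, n - Suc p) = 0" if "m < n" for m
    using z_opp[OF that] zskew[of m "n - Suc p"] that ap by simp
  have z_lead: "z $$ (i, j) = 0" if "i < a" "j < n" for i j
    unfolding z_def
    using borel_carrierD[OF C] yc that a_least ap by (intro cong_mat_leading_rows) auto
  have zpa: "z $$ (p, a) = - y $$ (a, p)" using zskew[of p a] z_row'[of p] ap by simp

  define w where "w k = (if k < n - Suc a \<and> k \<noteq> a then z $$ (p, n - Suc k) / z $$ (p, a) else 0)" for k
  define D where "D = siegel n a w"
  \<comment> \<open>For \<open>i\<close> outside \<open>T\<close>, row \<open>i\<close> of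
    \<open>z\<close> depends only on row \<open>i\<close> of \<open>y\<close>, which is zero. Hence
    \<open>D\<close> can be kept inside \<open>T\<close> as well.\<close>
  have ztp: "z $$ (i, j) = 0" if "i < n" "j < n" "i \<notin> T \<or> j \<notin> T" for i j
  proof -
    have "z $$ (i, j) = 0" if ij: "i < n" "j < n" "i \<notin> T" for i j
    proof -
      have "(\<Sum>m<n. y $$ (k, m) * C $$ (m, j)) * C $$ (k, i) = 0" if k: "k < n" for k
      proof (cases "k = i")
        case True
        then show ?thesis using supp[of i] ij by simp
      next
        case False
        then show ?thesis using CT ij k unfolding id_off_def by simp
      qed
      then show ?thesis
        using ij borel_carrierD[OF C] yc by (simp add: z_def cong_mat_index sum.neutral)
    qed
    then show ?thesis using that zskew[of i j] by auto
  qed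
  have D: "D \<in> carrier (borel_group n)" unfolding D_def
    using ap aa by (intro siegel_borel) (auto simp: w_def split: if_splits)
  have DT: "id_off n T D" unfolding D_def
  proof (rule siegel_id_off[OF aT(1) T])
    fix k assume k: "k < n" "k \<notin> T"
    then have "n - Suc (n - Suc k) \<notin> T" by simp
    then have "n - Suc k \<notin> T" using T(2) by metis
    then show "w k = 0" using ztp[of p "n - Suc k"] ap k by (simp add: w_def)
  qed
  \<comment> \<open>The column opposite to \<open>p\<close> is zero in \<open>z\<close>, so
    \<open>D\<close> does not spread the pivot of row \<open>a\<close> into column
    \<open>n - Suc a\<close>.\<close>
  have wp: "w p = 0" using z_opp'[of p] ap by (simp add: w_def)
  have wp': "w (n - Suc p) = 0" using zdiag[of p] ap by (simp add: w_def)
  have wa': "w (n - Suc a) = 0" by (simp add: w_def)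
  have x: "null_form n (cong_mat D z)" using D z by (rule null_form_cong)
  have x_a: "cong_mat D z $$ (a, j) = (if j = p then y $$ (a, p) else 0)" if j: "j < n" for j
  proof -
    have "cong_mat D z $$ (a, j) = (\<Sum>m<n. z $$ (a, m) * D $$ (m, j))"
      unfolding D_def using ap j aa wa' by (subst cong_mat_siegel[OF zc]) auto
    also have "\<dots> = z $$ (a, j) + (if j = n - Suc a then (\<Sum>k<n. z $$ (a, k) * w k) else 0)"
      unfolding D_def using ap j zdiag by (simp add: siegel_sum)
    also have "(\<Sum>k<n. z $$ (a, k) * w k) = 0"
      using z_row' wp by (intro sum.neutral) auto
    finally show ?thesis using z_row'[OF j] by simp
  qed
  have x_p: "cong_mat D z $$ (p, j) = (if j = a then - y $$ (a, p) else 0)"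
    if j: "j < n" "j \<noteq> n - Suc a" for j
  proof -
    have "cong_mat D z $$ (p, j) = (\<Sum>m<n. z $$ (p, m) * D $$ (m, j))"
      unfolding D_def using ap j pa wp' by (subst cong_mat_siegel[OF zc]) auto
    also have "\<dots> = z $$ (p, j) - z $$ (p, a) * w (n - Suc j)"
      unfolding D_def using ap j by (simp add: siegel_sum)
    also have "\<dots> = (if j = a then - y $$ (a, p) else 0)"
    proof (cases j a rule: linorder_cases)
      case less
      then show ?thesis using z_lead[of j p] zskew[of p j] ap by (auto simp: w_def)
    next
      case equal
      then show ?thesis using wa' zpa by simp
    next
      case greater
      then have "n - Suc j < n - Suc a" "n - Suc j \<noteq> a" using j ap by auto
      then show ?thesis using greater j ap zpa by (simp add: w_def)
    qed
    finally show ?thesis .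
  qed
  have "cong_mat D z $$ (p, n - Suc a) = 0"
    by (rule isotropic_two_terms[OF null_form_row[OF x ap(2)] ap(1) aa]) (use x_p ap aa in auto)
  then have x_p': "cong_mat D z $$ (p, j) = (if j = a then - y $$ (a, p) else 0)" if "j < n" for j
    using x_p[OF that] aa by (cases "j = n - Suc a") auto
  have CD: "cong_mat (C * D) y = cong_mat D z"
    unfolding z_def using borel_carrierD[OF C] borel_carrierD[OF D] yc by (intro cong_mat_mult)
  have "id_off n T (C * D)"
    using borel_carrierD[OF C] borel_carrierD[OF D] CT DT by (intro id_off_mult)
  then show ?thesis
    using borel_mult[OF C D] x_a x_p' ap by (intro bexI[of _ "C * D"]) (auto simp: CD)
qed

section \<open>Induction on the remaining indices\<close>

lemma borel_one: "1\<^sub>m n \<in> carrier (borel_group n)"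
  using subgroup.one_closed[OF subgroup_borel] by simp

lemma cong_mat_one: "y \<in> carrier_mat n n \<Longrightarrow> cong_mat (1\<^sub>m n) y = y"
  by (simp add: cong_mat_def transpose_one)

text \<open>Column \<open>i\<close> of \<open>C\<close> is a unit vector, so the left factor does
  nothing to row \<open>i\<close>; the right factor does nothing either, since the row is zero in
  the columns of \<open>T\<close>.\<close>

lemma cong_mat_id_off_fixed:
  assumes C: "C \<in> carrier_mat n n" "id_off n T C" and y: "y \<in> carrier_mat n n"
    and ij: "i < n" "j < n" "i \<notin> T" and z: "\<And>m. m < n \<Longrightarrow> m \<in> T \<Longrightarrow> y $$ (i, m) = 0"
  shows "cong_mat C y $$ (i, j) = y $$ (i, j)"
proof -
  have "cong_mat C y $$ (i, j) =
      (\<Sum>k<n. if k = i then (\<Sum>m<n. y $$ (k, m) * C $$ (m, j)) else 0)"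
    unfolding cong_mat_index[OF C(1) y ij(1,2)] using C(2) ij
    by (intro sum.cong) (auto simp: id_off_def)
  also have "\<dots> = (\<Sum>m<n. y $$ (i, m) * C $$ (m, j))" using ij by simp
  also have "\<dots> = (\<Sum>m<n. if m = j then y $$ (i, j) else 0)"
  proof (intro sum.cong refl)
    fix m assume m: "m \<in> {..<n}"
    show "y $$ (i, m) * C $$ (m, j) = (if m = j then y $$ (i, j) else 0)"
      using z[of m] C(2) m ij by (cases "m \<in> T") (auto simp: id_off_def)
  qed
  finally show ?thesis using ij by simp
qed

text \<open>Column \<open>i\<close> of \<open>C\<close> is supported in \<open>T\<close>, so only
  the rows in \<open>T\<close> are read. This lets the induction replace a form by its part on
  \<open>T\<close>.\<close>

lemma cong_mat_id_off_cong:
  assumes C: "C \<in> carrier_mat n n" "id_off n T C"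
    and y: "y \<in> carrier_mat n n" "z \<in> carrier_mat n n"
    and ij: "i < n" "j < n" "i \<in> T" and e: "\<And>k m. k \<in> T \<Longrightarrow> k < n \<Longrightarrow> m < n \<Longrightarrow> y $$ (k, m) = z $$ (k, m)"
  shows "cong_mat C y $$ (i, j) = cong_mat C z $$ (i, j)"
proof -
  have "(\<Sum>m<n. y $$ (k, m) * C $$ (m, j)) * C $$ (k, i) =
      (\<Sum>m<n. z $$ (k, m) * C $$ (m, j)) * C $$ (k, i)" if "k < n" for k
    using e[of k] C(2) ij that by (cases "k \<in> T") (auto simp: id_off_def)
  then show ?thesis
    unfolding cong_mat_index[OF C(1) y(1) ij(1,2)] cong_mat_index[OF C(1) y(2) ij(1,2)]
    by (intro sum.cong) auto
qed

lemma monomial_reduction: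
  assumes "T \<subseteq> {..<n}" "\<And>i. i \<in> T \<Longrightarrow> n - Suc i \<in> T"
    and "null_form n y" "\<And>i j. i < n \<Longrightarrow> j < n \<Longrightarrow> y $$ (i, j) \<noteq> 0 \<Longrightarrow> i \<in> T"
  shows "\<exists>C\<in>carrier (borel_group n). id_off n T C \<and> monomial_rows n (cong_mat C y)"
  using assms
proof (induction "card T" arbitrary: T y rule: less_induct)
  case less
  note T = less.prems(1,2) and y = less.prems(3) and supp = less.prems(4)
  have yc: "y \<in> carrier_mat n n" using y by (rule null_form_carrier)
  show ?case
  proof (cases "\<exists>i<n. \<exists>j<n. y $$ (i, j) \<noteq> 0")
    case False
    then have "monomial_rows n (cong_mat (1\<^sub>m n) y)" using yc by (auto simp: monomial_rows_def cong_mat_one)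
    then show ?thesis using borel_one by (intro bexI[of _ "1\<^sub>m n"]) (auto simp: id_off_def)
  next
    case True
    define a where "a = (LEAST i. i < n \<and> (\<exists>j<n. y $$ (i, j) \<noteq> 0))"
    have a: "a < n" "\<exists>j<n. y $$ (a, j) \<noteq> 0"
      using LeastI_ex[OF True] unfolding a_def by auto
    have a_least: "y $$ (i, j) = 0" if "i < a" "j < n" for i j
      using not_less_Least[of i "\<lambda>i. i < n \<and> (\<exists>j<n. y $$ (i, j) \<noteq> 0)"] that a(1) unfolding a_def[symmetric] by auto
    define p where "p = (LEAST j. j < n \<and> y $$ (a, j) \<noteq> 0)"
    have p: "p < n" "y $$ (a, p) \<noteq> 0"
      using LeastI_ex[OF a(2)] unfolding p_def by auto
    have p_least: "y $$ (a, j) = 0" if "j < p" for j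
      using not_less_Least[of j "\<lambda>j. j < n \<and> y $$ (a, j) \<noteq> 0"] that p(1) unfolding p_def[symmetric] by auto
    obtain C where C: "C \<in> carrier (borel_group n)" "id_off n T C"
      and Ca: "\<And>j. j < n \<Longrightarrow> cong_mat C y $$ (a, j) \<noteq> 0 \<longleftrightarrow> j = p"
      and Cp: "\<And>j. j < n \<Longrightarrow> cong_mat C y $$ (p, j) \<noteq> 0 \<longleftrightarrow> j = a"
    proof -
      have "\<exists>C\<in>carrier (borel_group n). id_off n T C \<and>
          (\<forall>j<n. cong_mat C y $$ (a, j) \<noteq> 0 \<longleftrightarrow> j = p) \<and>
          (\<forall>j<n. cong_mat C y $$ (p, j) \<noteq> 0 \<longleftrightarrow> j = a)"
        by (rule pivot_reduction) (fact T y supp a(1) p a_least p_least)+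
      then show ?thesis using that by blast
    qed
    define x where "x = cong_mat C y"
    have x: "null_form n x" unfolding x_def using C(1) y by (rule null_form_cong)
    have xc: "x \<in> carrier_mat n n" using x by (rule null_form_carrier)
    have skew: "x $$ (i, j) = - x $$ (j, i)" if "i < n" "j < n" for i j
      using null_form_skew[OF x that] .
    have xa: "x $$ (a, j) \<noteq> 0 \<longleftrightarrow> j = p" and xp: "x $$ (p, j) \<noteq> 0 \<longleftrightarrow> j = a" if "j < n" for j
      using Ca[OF that] Cp[OF that] by (auto simp: x_def)
    have xp': "x $$ (n - Suc p, j) = 0" if "j < n" for j
      by (rule null_form_opposite_row[OF x a(1) p(1) that]) (use xa p in auto)
    have xa': "x $$ (n - Suc a, j) = 0" if "j < n" for j
      by (rule null_form_opposite_row[OF x p(1) a(1) that]) (use xp a in auto)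
    \<comment> \<open>Rows \<open>a\<close> and \<open>p\<close> now hold one entry each and the
      opposite rows are zero. All four indices leave together, which keeps \<open>S\<close> closed
      under opposites.\<close>
    define S where "S = T - {a, p, n - Suc a, n - Suc p}"
    \<comment> \<open>By skewness the entry \<open>(j, i)\<close> can be examined instead: row
      \<open>j\<close> is one of the four rows just removed, or lies outside \<open>T\<close> and is
      still zero.\<close>
    have off: "x $$ (i, j) = 0" if "i < n" "j < n" "i \<in> S" "j \<notin> S" for i j
    proof -
      have "x $$ (j, i) = 0"
      proof (cases "j \<in> T")
        case True
        then have "j = a \<or> j = p \<or> j = n - Suc a \<or> j = n - Suc p" using that(4) by (auto simp: S_def)
        moreover have "i \<noteq> a" "i \<noteq> p" using that by (auto simp: S_def)
        ultimately show ?thesis using xa[OF that(1)] xp[OF that(1)] xa'[OF that(1)] xp'[OF that(1)] by auto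
      next
        case False
        have "cong_mat C y $$ (j, i) = y $$ (j, i)"
          using borel_carrierD(1)[OF C(1)] C(2) yc that False
        proof (intro cong_mat_id_off_fixed[where T = T])
          fix m assume "m < n" then show "y $$ (j, m) = 0" using supp[of j m] that False by auto
        qed auto
        then show ?thesis using supp[of j i] that False by (auto simp: x_def)
      qed
      then show ?thesis using skew[OF that(1,2)] by simp
    qed
    \<comment> \<open>By \<open>off\<close> this is the diagonal block of \<open>x\<close> on
      \<open>S\<close>, to which the induction hypothesis applies.\<close>
    define z where "z = mat n n (\<lambda>(i, j). if i \<in> S then x $$ (i, j) else 0)"
    have zc: "z \<in> carrier_mat n n" by (simp add: z_def)
    have zi: "z $$ (i, j) = (if i \<in> S then x $$ (i, j) else 0)" if "i < n" "j < n" for i j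
      using that by (simp add: z_def)
    have SS: "S \<subseteq> {..<n}" using T by (auto simp: S_def)
    have ST: "n - Suc i \<in> S" if "i \<in> S" for i
    proof -
      have "i < n" using SS that by auto
      then have "i = n - Suc b" if "n - Suc i = b" for b using that by auto
      moreover have "i = b" if "n - Suc i = n - Suc b" "b < n" for b using that \<open>i < n\<close> by auto
      ultimately show ?thesis using \<open>i \<in> S\<close> T(2)[of i] a(1) p(1) unfolding S_def by blast
    qed
    have aT: "a \<in> T" using supp[OF a(1) p] .
    have "S \<subset> T" using aT by (auto simp: S_def)
    then have "card S < card T" using T(1) by (meson finite_lessThan finite_subset psubset_card_mono)
    moreover have "null_form n z"
      unfolding null_form_iff
    proof (intro conjI allI impI zc)
      fix i j assume ij: "i < n" "j < n"
      show "z $$ (i, j) = - z $$ (j, i)"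
        using skew[OF ij] off[OF ij] off[OF ij(2,1)] ij by (auto simp: zi)
      show "(\<Sum>k<n. z $$ (i, k) * z $$ (n - Suc k, j)) = 0"
      proof (cases "i \<in> S")
        case True
        \<comment> \<open>A nonzero first factor forces \<open>k\<close>, hence also its opposite,
          into \<open>S\<close>, where \<open>z\<close> agrees with \<open>x\<close>.\<close>
        have "z $$ (i, k) * z $$ (n - Suc k, j) = x $$ (i, k) * x $$ (n - Suc k, j)" if "k < n" for k
          using True that ij off[of i k] ST[of k] by (auto simp: zi)
        then show ?thesis using null_form_sum[OF x ij] by simp
      qed (use ij in \<open>simp add: zi\<close>)
    qed
    moreover have "i \<in> S" if "i < n" "j < n" "z $$ (i, j) \<noteq> 0" for i j
      using that by (auto simp: zi split: if_splits)
    ultimately obtain D where D: "D \<in> carrier (borel_group n)" "id_off n S D"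
      and mono: "monomial_rows n (cong_mat D z)"
      using less.hyps[of S z] SS ST by blast
    have Dc: "D \<in> carrier_mat n n" using borel_carrierD(1)[OF D(1)] .
    have in_S: "cong_mat D x $$ (i, j) = cong_mat D z $$ (i, j)" if "i \<in> S" "i < n" "j < n" for i j
      using that zi by (intro cong_mat_id_off_cong[OF Dc D(2) xc zc]) auto
    have not_S: "cong_mat D x $$ (i, j) = x $$ (i, j)" if "i \<notin> S" "i < n" "j < n" for i j
      using that off skew[of i] by (intro cong_mat_id_off_fixed[OF Dc D(2) xc]) auto
    have x_out: "j = k" if "i \<notin> S" "i < n" "j < n" "k < n" "x $$ (i, j) \<noteq> 0" "x $$ (i, k) \<noteq> 0" for i j k
    proof (cases "i \<in> T")
      case True
      then have "i = a \<or> i = p \<or> i = n - Suc a \<or> i = n - Suc p" using that(1) by (auto simp: S_def)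
      then show ?thesis
        using that(5,6) xa[OF that(3)] xa[OF that(4)] xp[OF that(3)] xp[OF that(4)]
          xa'[OF that(3)] xp'[OF that(3)]
        by (elim disjE) simp_all
    next
      case False
      have "cong_mat C y $$ (i, j) = y $$ (i, j)"
      proof (rule cong_mat_id_off_fixed[OF borel_carrierD(1)[OF C(1)] C(2) yc that(2,3) False])
        fix m assume "m < n" then show "y $$ (i, m) = 0" using supp[of i m] that False by auto
      qed
      then show ?thesis using supp[of i j] that False by (auto simp: x_def)
    qed
    have "monomial_rows n (cong_mat D x)"
      unfolding monomial_rows_def
    proof (intro allI impI)
      fix i j k assume ijk: "i < n" "j < n" "k < n"
        and nz: "cong_mat D x $$ (i, j) \<noteq> 0" "cong_mat D x $$ (i, k) \<noteq> 0"
      show "j = k"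
      proof (cases "i \<in> S")
        case True
        then show ?thesis using mono nz ijk in_S[OF True] unfolding monomial_rows_def by metis
      next
        case False
        then show ?thesis using x_out[OF False ijk] nz not_S[OF False] ijk by simp
      qed
    qed
    moreover have "cong_mat (C * D) y = cong_mat D x"
      unfolding x_def using borel_carrierD(1)[OF C(1)] Dc yc by (intro cong_mat_mult)
    moreover have "id_off n T (C * D)"
      using borel_carrierD(1)[OF C(1)] Dc C(2) id_off_mono[OF D(2)] by (intro id_off_mult) (auto simp: S_def)
    ultimately show ?thesis using borel_mult[OF C(1) D(1)] by auto
  qed
qed

section \<open>Matchings as a complete invariant\<close>

definition support_rel :: "nat \<Rightarrow> complex mat \<Rightarrow> (nat \<times> nat) set" where
  "support_rel n y = {(i, j). i < n \<and> j < n \<and> y $$ (i, j) \<noteq> 0}"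

text \<open>With symmetry, the last clause also rules out that an index is matched with its
  opposite, and that a middle index is matched at all.\<close>

definition isotropic_matching :: "nat \<Rightarrow> (nat \<times> nat) set \<Rightarrow> bool" where
  "isotropic_matching n R \<longleftrightarrow> R \<subseteq> {..<n} \<times> {..<n} \<and> sym R \<and> (\<forall>i. (i, i) \<notin> R) \<and>
     (\<forall>i j k. (i, j) \<in> R \<longrightarrow> (i, k) \<in> R \<longrightarrow> j = k) \<and>
     (\<forall>i j k. (i, j) \<in> R \<longrightarrow> (n - Suc i, k) \<notin> R)"

definition sign_mat :: "nat \<Rightarrow> (nat \<times> nat) set \<Rightarrow> complex mat" where
  "sign_mat n R = mat n n (\<lambda>(i, j). if (i, j) \<in> R then if i < j then 1 else - 1 else 0)"

lemma isotropic_matchingD: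
  assumes "isotropic_matching n R"
  shows "(i, j) \<in> R \<Longrightarrow> i < n" "(i, j) \<in> R \<Longrightarrow> j < n" "(i, j) \<in> R \<Longrightarrow> (j, i) \<in> R"
    "(i, i) \<notin> R" "(i, j) \<in> R \<Longrightarrow> (i, k) \<in> R \<Longrightarrow> j = k" "(i, j) \<in> R \<Longrightarrow> (n - Suc i, k) \<notin> R"
  using assms unfolding isotropic_matching_def sym_def by blast+

text \<open>For the last clause, the partner \<open>j\<close> of \<open>i\<close> has its only entry
  in column \<open>i\<close>, so the row opposite to \<open>i\<close> vanishes by
  \<open>null_form_opposite_row\<close>.\<close>

lemma isotropic_matching_support:
  assumes y: "null_form n y" and m: "monomial_rows n y"
  shows "isotropic_matching n (support_rel n y)"
  unfolding isotropic_matching_def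
proof (intro conjI allI impI)
  show "sym (support_rel n y)"
  proof (rule symI)
    fix i j assume "(i, j) \<in> support_rel n y"
    then show "(j, i) \<in> support_rel n y"
      using null_form_skew[OF y, of i j] by (auto simp: support_rel_def)
  qed
  show "(i, i) \<notin> support_rel n y" for i
    using null_form_skew[OF y, of i i] by (auto simp: support_rel_def)
  show "j = k" if "(i, j) \<in> support_rel n y" "(i, k) \<in> support_rel n y" for i j k
    using that m unfolding support_rel_def monomial_rows_def by blast
  fix i j k assume "(i, j) \<in> support_rel n y"
  then have ij: "i < n" "j < n" "y $$ (i, j) \<noteq> 0" by (auto simp: support_rel_def)
  then have ji: "y $$ (j, i) \<noteq> 0" using null_form_skew[OF y, of i j] by auto
  have "y $$ (n - Suc i, k) = 0" if "k < n"
    using ij ji m that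
    by (intro null_form_opposite_row[OF y ij(2,1) that ji]) (auto simp: monomial_rows_def)
  then show "(n - Suc i, k) \<notin> support_rel n y" by (auto simp: support_rel_def)
qed (auto simp: support_rel_def)

section \<open>Sign matrices as representatives\<close>

lemma sign_mat_carrier: "sign_mat n R \<in> carrier_mat n n"
  by (simp add: sign_mat_def)

lemma support_sign_mat:
  assumes "isotropic_matching n R"
  shows "support_rel n (sign_mat n R) = R"
proof -
  have "R \<subseteq> {..<n} \<times> {..<n}" using assms by (simp add: isotropic_matching_def)
  then show ?thesis by (fastforce simp: support_rel_def sign_mat_def split: if_splits)
qed

lemma monomial_sign_mat: "isotropic_matching n R \<Longrightarrow> monomial_rows n (sign_mat n R)"
  unfolding monomial_rows_def sign_mat_def by (auto dest: isotropic_matchingD(5))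

text \<open>Every summand of \<open>y J y\<close> vanishes: if \<open>k\<close> is matched, its
  opposite is not.\<close>

lemma null_form_sign_mat:
  assumes R: "isotropic_matching n R"
  shows "null_form n (sign_mat n R)"
  unfolding null_form_iff
proof (intro conjI allI impI sign_mat_carrier)
  note D = isotropic_matchingD[OF R]
  fix i j assume ij: "i < n" "j < n"
  show "sign_mat n R $$ (i, j) = - sign_mat n R $$ (j, i)"
    using ij D(3)[of i j] D(3)[of j i] D(4)[of i] by (cases i j rule: linorder_cases) (auto simp: sign_mat_def)
  show "(\<Sum>k<n. sign_mat n R $$ (i, k) * sign_mat n R $$ (n - Suc k, j)) = 0"
  proof (rule sum.neutral, safe)
    fix k assume "k < n"
    then show "sign_mat n R $$ (i, k) * sign_mat n R $$ (n - Suc k, j) = 0"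
      using ij D(6)[OF D(3), of i k j] by (auto simp: sign_mat_def)
  qed
qed

lemma torus_scaling:
  assumes y: "null_form n y" and m: "monomial_rows n y"
  shows "\<exists>C\<in>carrier (borel_group n). cong_mat C y = sign_mat n (support_rel n y)"
proof -
  define R where "R = support_rel n y"
  have R: "isotropic_matching n R" unfolding R_def using y m by (rule isotropic_matching_support)
  note RD = isotropic_matchingD[OF R]
  have yc: "y \<in> carrier_mat n n" using y by (rule null_form_carrier)
  \<comment> \<open>Scale only the larger index of each pair; its opposite is not in the support.\<close>
  define s where "s i = (if \<exists>j<i. (i, j) \<in> R then y $$ (THE j. (i, j) \<in> R, i) else 1)" for i
  define d where "d i = s (n - Suc i) / s i" for i
  define C where "C = mat n n (\<lambda>(i, j). if i = j then d i else 0)"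
  have Cc: "C \<in> carrier_mat n n" by (simp add: C_def)
  have the: "(THE j. (i, j) \<in> R) = j" if "(i, j) \<in> R" for i j
    using that RD(5) by blast
  have s0: "s i \<noteq> 0" for i
  proof (cases "\<exists>j<i. (i, j) \<in> R")
    case True
    then obtain j where "(i, j) \<in> R" by blast
    moreover from this have "y $$ (j, i) \<noteq> 0" using RD(3) by (auto simp: R_def support_rel_def)
    ultimately show ?thesis using True by (simp add: s_def the)
  next
    case False
    then have "s i = 1" unfolding s_def by (rule if_not_P)
    then show ?thesis by simp
  qed
  \<comment> \<open>Opposite entries being mutually inverse is exactly orthogonality for a diagonal
    matrix; the quotient defining \<open>d\<close> ensures it.\<close>
  have dd: "d (n - Suc i) * d i = 1" if "i < n" for i
    using s0 that by (simp add: d_def)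
  have "C \<in> carrier (borel_group n)"
  proof (rule borelI[OF Cc])
    show "upper_triangular C" by (auto simp: C_def upper_triangular_def)
    show "transpose_mat C * J_mat n * C = J_mat n"
    proof (rule eq_matI)
      fix i j assume "i < dim_row (J_mat n)" "j < dim_col (J_mat n)"
      then have ij: "i < n" "j < n" by (simp_all add: J_mat_def)
      have "(transpose_mat C * J_mat n * C) $$ (i, j) =
          (\<Sum>k<n. C $$ (n - Suc k, j) * C $$ (k, i))"
        using Cc ij by (rule J_form_index)
      also have "\<dots> = (\<Sum>k<n. if k = i then if j = n - Suc i then 1 else 0 else 0)"
        using ij dd[of i] by (intro sum.cong) (auto simp: C_def)
      also have "\<dots> = J_mat n $$ (i, j)" using ij by (auto simp: J_mat_def)
      finally show "(transpose_mat C * J_mat n * C) $$ (i, j) = J_mat n $$ (i, j)" .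
    qed (use Cc in \<open>simp_all add: J_mat_def\<close>)
  qed
  moreover have "cong_mat C y = sign_mat n R"
  proof (rule eq_matI)
    fix i j assume "i < dim_row (sign_mat n R)" "j < dim_col (sign_mat n R)"
    then have ij: "i < n" "j < n" by (simp_all add: sign_mat_def)
    \<comment> \<open>The opposites of \<open>i\<close> and \<open>j\<close> are unmatched and the
      partner of \<open>i\<close> is larger, so \<open>s\<close> is 1 at these three places and only
      \<open>s j\<close>, the entry itself, remains.\<close>
    have scaled: "d i * d j * y $$ (i, j) = 1" if "(i, j) \<in> R" "i < j" for i j
    proof -
      have "s (n - Suc i) = 1" "s (n - Suc j) = 1"
        using RD(6)[OF that(1)] RD(6)[OF RD(3)[OF that(1)]] by (auto simp: s_def)
      moreover have "\<not> (\<exists>k<i. (i, k) \<in> R)"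
      proof safe
        fix k assume "k < i" "(i, k) \<in> R"
        then show False using RD(5)[OF that(1), of k] that(2) by simp
      qed
      then have "s i = 1" unfolding s_def by (rule if_not_P)
      moreover have "s j = y $$ (i, j)" using that RD(3)[OF that(1)] by (auto simp: s_def the)
      ultimately show ?thesis using s0[of j] by (simp add: d_def)
    qed
    have "cong_mat C y $$ (i, j) = (\<Sum>k<n. (\<Sum>m<n. y $$ (k, m) * C $$ (m, j)) * C $$ (k, i))"
      using Cc yc ij by (rule cong_mat_index)
    also have "\<dots> = (\<Sum>k<n. if k = i then y $$ (i, j) * d j * d i else 0)"
    proof (rule sum.cong)
      fix k assume k: "k \<in> {..<n}"
      have "(\<Sum>m<n. y $$ (k, m) * C $$ (m, j)) = (\<Sum>m<n. if m = j then y $$ (k, j) * d j else 0)"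
        using ij by (intro sum.cong) (auto simp: C_def)
      then show "(\<Sum>m<n. y $$ (k, m) * C $$ (m, j)) * C $$ (k, i) =
          (if k = i then y $$ (i, j) * d j * d i else 0)"
        using ij k by (auto simp: C_def)
    qed simp
    also have "\<dots> = d i * d j * y $$ (i, j)" using ij by simp
    also have "\<dots> = sign_mat n R $$ (i, j)"
    proof (cases "(i, j) \<in> R")
      case True
      then show ?thesis
        using scaled[OF True] scaled[OF RD(3)[OF True]] null_form_skew[OF y ij] RD(4)[of i] ij
        by (cases i j rule: linorder_cases) (auto simp: sign_mat_def mult_ac)
    next
      case False
      then show ?thesis using ij by (simp add: sign_mat_def) (simp add: R_def support_rel_def)
    qed
    finally show "cong_mat C y $$ (i, j) = sign_mat n R $$ (i, j)" .
  qed (use cong_mat_carrier[OF Cc yc] in \<open>simp_all add: sign_mat_def\<close>)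
  ultimately show ?thesis by (auto simp: R_def)
qed

section \<open>Invariance of the support\<close>

lemma borel_inv_cong:
  assumes "C \<in> carrier (borel_group n)" "y \<in> carrier_mat n n"
  shows "cong_mat (inv\<^bsub>GL n\<^esub> C) (cong_mat C y) = y"
  using assms GL_inv[OF borel_carrierD(2)[OF assms(1)]] borel_carrierD[OF assms(1)]
  by (simp add: cong_mat_mult[symmetric] cong_mat_one)

text \<open>The inverse is triangular too, so diagonal entries of \<open>C\<close> and of its
  inverse multiply to 1.\<close>

lemma borel_diag_nonzero:
  assumes C: "C \<in> carrier (borel_group n)" and j: "j < n"
  shows "C $$ (j, j) \<noteq> 0"
proof
  assume z: "C $$ (j, j) = 0"
  let ?D = "inv\<^bsub>GL n\<^esub> C"
  have D: "?D \<in> carrier (borel_group n)" using C by (rule borel_inv)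
  note c = borel_carrierD(1,4)[OF C] borel_carrierD(1,4)[OF D]
  have "C $$ (j, k) * ?D $$ (k, j) = 0" if "k < n" for k
    using z c that j by (cases j k rule: linorder_cases) (auto simp: upper_triangular_def)
  then have "(C * ?D) $$ (j, j) = 0"
    unfolding mult_mat_index[OF c(1,3) j j] by (simp add: sum.neutral)
  then show False using GL_inv(4)[OF borel_carrierD(2)[OF C]] j by simp
qed

lemma cong_mat_support_above:
  assumes C: "C \<in> carrier (borel_group n)" and y: "y \<in> carrier_mat n n" "monomial_rows n y"
    and ij: "(i, j) \<in> support_rel n y"
  shows "\<exists>k\<le>i. (k, j) \<in> support_rel n (cong_mat C y)"
proof (rule ccontr)
  assume no: "\<not> ?thesis"
  \<comment> \<open>Compare entry \<open>(i, j)\<close> in \<open>D\<^sup>T (C\<^sup>T y C) = y C\<close>, where \<open>D\<^sup>T\<close> is lower and \<open>C\<close> upper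
    triangular.\<close>
  let ?D = "inv\<^bsub>GL n\<^esub> C"
  note c = borel_carrierD[OF C] and d = borel_carrierD[OF borel_inv[OF C]]
  have ijn: "i < n" "j < n" "y $$ (i, j) \<noteq> 0" using ij by (auto simp: support_rel_def)
  have xc: "cong_mat C y \<in> carrier_mat n n" using c(1) y(1) by (rule cong_mat_carrier)
  have t: "transpose_mat C \<in> carrier_mat n n" "transpose_mat ?D \<in> carrier_mat n n" using c d by simp_all
  have "transpose_mat ?D * transpose_mat C = 1\<^sub>m n"
    using transpose_mult[OF c(1) d(1)] GL_inv(4)[OF c(2)] by (simp add: transpose_one)
  moreover have "transpose_mat ?D * cong_mat C y = (transpose_mat ?D * transpose_mat C) * (y * C)"
    using c t y by (simp add: cong_mat_def assoc_mult_mat[of _ n n _ n _ n] mult_carrier_mat[of _ n n _ n])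
  ultimately have e: "transpose_mat ?D * cong_mat C y = y * C" using y c by simp
  have "(y * C) $$ (i, j) = (\<Sum>k<n. if k = j then y $$ (i, j) * C $$ (j, j) else 0)"
    unfolding mult_mat_index[OF y(1) c(1) ijn(1,2)]
    using y(2) ijn by (intro sum.cong) (auto simp: monomial_rows_def)
  then have nz: "(y * C) $$ (i, j) \<noteq> 0" using ijn borel_diag_nonzero[OF C] by simp
  have "transpose_mat ?D $$ (i, k) * cong_mat C y $$ (k, j) = 0" if "k < n" for k
    using no that ijn d by (cases "k \<le> i") (auto simp: support_rel_def upper_triangular_def)
  then have "(transpose_mat ?D * cong_mat C y) $$ (i, j) = 0"
    unfolding mult_mat_index[OF t(2) xc ijn(1,2)] by (simp add: sum.neutral)
  then show False using nz e by simp
qed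

text \<open>Going to the transformed form and back by \<open>cong_mat_support_above\<close> moves an
  entry up within its column. Since \<open>y\<close> has one entry per column, it returns to its
  place, and the row in between is squeezed to the same index. The inverse of \<open>C\<close> gives
  the other inclusion.\<close>

lemma support_cong_mat:
  assumes C: "C \<in> carrier (borel_group n)" and y: "null_form n y" "monomial_rows n y"
    and x: "monomial_rows n (cong_mat C y)"
  shows "support_rel n (cong_mat C y) = support_rel n y"
proof -
  have *: "support_rel n y \<subseteq> support_rel n (cong_mat C y)"
    if C: "C \<in> carrier (borel_group n)" and y: "null_form n y" "monomial_rows n y"
      and x: "monomial_rows n (cong_mat C y)" for C y
  proof safe
    fix i j assume ij: "(i, j) \<in> support_rel n y"
    have yc: "y \<in> carrier_mat n n" using y(1) by (rule null_form_carrier)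
    note M = isotropic_matchingD[OF isotropic_matching_support[OF y]]
    obtain k where k: "k \<le> i" "(k, j) \<in> support_rel n (cong_mat C y)"
      using cong_mat_support_above[OF C yc y(2) ij] by blast
    obtain m where m: "m \<le> k" "(m, j) \<in> support_rel n y"
      using cong_mat_support_above[OF borel_inv[OF C] cong_mat_carrier[OF borel_carrierD(1)[OF C] yc] x k(2)]
        borel_inv_cong[OF C yc] by auto
    have "m = i" using M(5)[OF M(3)[OF m(2)] M(3)[OF ij]] .
    then show "(i, j) \<in> support_rel n (cong_mat C y)" using k m by simp
  qed
  have yc: "y \<in> carrier_mat n n" using y(1) by (rule null_form_carrier)
  show ?thesis
    using *[OF C y x] *[OF borel_inv[OF C] null_form_cong[OF C y(1)] x] y(2)
    by (simp add: borel_inv_cong[OF C yc] subset_antisym)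
qed

section \<open>Orbits and matchings\<close>

lemma conjugation_J:
  assumes C: "C \<in> carrier (borel_group n)" and y: "null_form n y"
  shows "conjugation n (inv\<^bsub>GL n\<^esub> C) (J_mat n * y) = J_mat n * cong_mat C y"
  using y borel_carrierD[OF C]
  by (simp add: conjugation_def null_form_def J_conj GL_inv_inv)

lemma mem_orbit_iff:
  assumes y: "null_form n y"
  shows "x \<in> orbit (borel_group n) (conjugation n) (J_mat n * y) \<longleftrightarrow>
    (\<exists>C\<in>carrier (borel_group n). x = J_mat n * cong_mat C y)"
proof -
  have "(\<exists>A\<in>carrier (borel_group n). x = conjugation n A (J_mat n * y)) \<longleftrightarrow>
      (\<exists>C\<in>carrier (borel_group n). x = conjugation n (inv\<^bsub>GL n\<^esub> C) (J_mat n * y))"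
    by (metis borel_inv borel_carrierD(2) GL_inv_inv)
  then show ?thesis by (auto simp: orbit_def conjugation_J[OF _ y])
qed

lemma bij_betw_matchings_orbits:
  "bij_betw (\<lambda>R. orbit (borel_group n) (conjugation n) (J_mat n * sign_mat n R))
     {R. isotropic_matching n R} (orbits (borel_group n) (nilpotent2 n) (conjugation n))"
  (is "bij_betw ?O _ _")
proof -
  interpret A: group_action "borel_group n" "nilpotent2 n" "conjugation n" by (rule group_action_borel)
  have nil: "J_mat n * sign_mat n R \<in> nilpotent2 n" if "isotropic_matching n R" for R
    using null_form_sign_mat[OF that] by (simp add: null_form_def)
  show ?thesis
    unfolding bij_betw_def
  proof
    show "inj_on ?O {R. isotropic_matching n R}"
    proof (rule inj_onI, clarsimp)
      fix R S assume R: "isotropic_matching n R" and S: "isotropic_matching n S" and e: "?O R = ?O S"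
      obtain C where C: "C \<in> carrier (borel_group n)"
        and JC: "J_mat n * sign_mat n S = J_mat n * cong_mat C (sign_mat n R)"
        using A.orbit_refl[OF nil[OF S]] mem_orbit_iff[OF null_form_sign_mat[OF R]] e by metis
      have c: "cong_mat C (sign_mat n R) = sign_mat n S"
        using J_mat_mult_cancel[OF cong_mat_carrier[OF borel_carrierD(1)[OF C] sign_mat_carrier[of n R]]]
          J_mat_mult_cancel[OF sign_mat_carrier[of n S]]
        unfolding JC by (rule trans[OF sym])
      show "R = S"
        using support_cong_mat[OF C null_form_sign_mat[OF R] monomial_sign_mat[OF R]]
          monomial_sign_mat[OF S] support_sign_mat[OF R] support_sign_mat[OF S]
        by (simp add: c)
    qed
    show "?O ` {R. isotropic_matching n R} = orbits (borel_group n) (nilpotent2 n) (conjugation n)"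
    proof
      show "?O ` {R. isotropic_matching n R} \<subseteq> orbits (borel_group n) (nilpotent2 n) (conjugation n)"
        using nil by (auto simp: orbits_def)
      show "orbits (borel_group n) (nilpotent2 n) (conjugation n) \<subseteq> ?O ` {R. isotropic_matching n R}"
      proof
        fix Q assume "Q \<in> orbits (borel_group n) (nilpotent2 n) (conjugation n)"
        then obtain x where x: "x \<in> nilpotent2 n" and Q: "Q = orbit (borel_group n) (conjugation n) x"
          by (auto simp: orbits_def)
        define y where "y = J_mat n * x"
        have "x \<in> carrier_mat n n" using x by (simp add: nilpotent2_def orthogonal_lie_def)
        then have yc: "y \<in> carrier_mat n n" and xy: "x = J_mat n * y"
          by (simp_all add: y_def J_mat_mult_cancel mult_carrier_mat[of _ n n _ n])
        have y: "null_form n y" using x yc by (simp add: null_form_def flip: xy)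
        \<comment> \<open>The induction starts from the full index set, where \<open>id_off\<close>
          is no restriction.\<close>
        have "\<exists>C\<in>carrier (borel_group n). id_off n {..<n} C \<and> monomial_rows n (cong_mat C y)"
          by (rule monomial_reduction[OF _ _ y]) auto
        then obtain C where C: "C \<in> carrier (borel_group n)" "monomial_rows n (cong_mat C y)" by blast
        have z: "null_form n (cong_mat C y)" using C(1) y by (rule null_form_cong)
        define R where "R = support_rel n (cong_mat C y)"
        have R: "isotropic_matching n R" unfolding R_def by (rule isotropic_matching_support[OF z C(2)])
        obtain D where D: "D \<in> carrier (borel_group n)" "cong_mat D (cong_mat C y) = sign_mat n R"
          using torus_scaling[OF z C(2)] by (auto simp: R_def)
        have CD: "cong_mat (C * D) y = sign_mat n R"
          using cong_mat_mult[OF borel_carrierD(1)[OF C(1)] borel_carrierD(1)[OF D(1)] yc] D(2) by simp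
        have mem: "J_mat n * sign_mat n R \<in> orbit (borel_group n) (conjugation n) x"
          unfolding xy mem_orbit_iff[OF y] CD[symmetric] using borel_mult[OF C(1) D(1)] by blast
        have mem': "x \<in> orbit (borel_group n) (conjugation n) (J_mat n * sign_mat n R)"
          using A.orbit_sym[OF x nil[OF R] mem] .
        have "Q \<subseteq> nilpotent2 n" "?O R \<subseteq> nilpotent2 n"
          using A.element_image x nil[OF R] unfolding Q orbit_def by blast+
        then have "Q = ?O R"
          using A.orbit_trans[OF x nil[OF R] _ mem] A.orbit_trans[OF nil[OF R] x _ mem'] unfolding Q by blast
        then show "Q \<in> ?O ` {R. isotropic_matching n R}" using R by blast
      qed
    qed
  qed
qed

section \<open>Link patterns as matchings\<close>

text \<open>The vertex \<open>v\<close> stands for the two opposite indices \<open>v - 1\<close> and \<open>n - v\<close>. An arrow is dotted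
  iff its two indices lie in the same half, and its orientation records which half if it is
  dotted, and which end lies in the first half otherwise.\<close>

definition arrow_tail :: "nat \<Rightarrow> arrow \<Rightarrow> nat" where
  "arrow_tail n a = (if dotted a \<and> target a < source a then n - source a else source a - 1)"

definition arrow_head :: "nat \<Rightarrow> arrow \<Rightarrow> nat" where
  "arrow_head n a = (if dotted a \<and> source a < target a then target a - 1 else n - target a)"

definition pattern_rel :: "nat \<Rightarrow> arrow set \<Rightarrow> (nat \<times> nat) set" where
  "pattern_rel n P = {(i, j). \<exists>a\<in>P. i = arrow_tail n a \<and> j = arrow_head n a \<or>
     i = arrow_head n a \<and> j = arrow_tail n a}"

text \<open>Folds opposite indices together. For odd \<open>n\<close> the middle index gets the
  vertex \<open>l + 1\<close>, outside the range of a pattern.\<close>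

definition vertex :: "nat \<Rightarrow> nat \<Rightarrow> nat" where
  "vertex n i = min (Suc i) (n - i)"

definition arrows :: "nat \<Rightarrow> arrow set" where
  "arrows l = {a. source a \<in> {1..l} \<and> target a \<in> {1..l} \<and> source a \<noteq> target a}"

lemma Oolp_iff:
  "P \<in> Oolp l \<longleftrightarrow> P \<subseteq> arrows l \<and>
     (\<forall>v. \<forall>a\<in>P. \<forall>b\<in>P. touches a v \<longrightarrow> touches b v \<longrightarrow> a = b)"
  unfolding Oolp_def arrows_def touches_def by auto

context
  fixes l n :: nat
  assumes n: "n \<in> {2 * l, 2 * l + 1}"
begin

lemma arrow_ends:
  assumes "a \<in> arrows l"
  shows "arrow_tail n a < n" "arrow_head n a < n"
    "vertex n (arrow_tail n a) = source a" "vertex n (arrow_head n a) = target a"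
  using assms n by (auto simp: arrows_def arrow_tail_def arrow_head_def vertex_def)

lemma vertex_eq_iff:
  assumes "i < n" "j < n"
  shows "vertex n i = vertex n j \<longleftrightarrow> i = j \<or> i = n - Suc j"
  using assms by (auto simp: vertex_def min_def)

lemma vertex_range:
  assumes "i < n" "i \<noteq> n - Suc i"
  shows "vertex n i \<in> {1..l}"
  using assms n by (auto simp: vertex_def min_def)

text \<open>The vertices of the two indices give source and target up to order; the halves in which
  the indices lie settle the dot and the orientation.\<close>

lemma arrow_inj:
  assumes "a \<in> arrows l" "b \<in> arrows l"
    and "arrow_tail n a = arrow_tail n b \<and> arrow_head n a = arrow_head n b \<or>
      arrow_tail n a = arrow_head n b \<and> arrow_head n a = arrow_tail n b"
  shows "a = b"
proof -
  have ends: "source a = source b \<and> target a = target b \<or> source a = target b \<and> target a = source b"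
    using assms(3) arrow_ends(3,4)[OF assms(1)] arrow_ends(3,4)[OF assms(2)] by auto
  obtain d u v d' u' v' where ab: "a = Arrow d u v" "b = Arrow d' u' v'" by (meson arrow.exhaust)
  have uv: "1 \<le> u" "u \<le> l" "1 \<le> v" "v \<le> l" "u \<noteq> v" using assms(1) by (auto simp: ab arrows_def)
  from ends show ?thesis
    unfolding ab arrow.sel
  proof (elim disjE conjE)
    assume "u = u'" "v = v'"
    then show "Arrow d u v = Arrow d' u' v'"
      using assms(3) uv n unfolding ab
      by (cases d; cases d'; cases "u < v") (auto simp: arrow_tail_def arrow_head_def)
  next
    assume "u = v'" "v = u'"
    then show "Arrow d u v = Arrow d' u' v'"
      using assms(3) uv n unfolding ab
      by (cases d; cases d'; cases "u < v") (auto simp: arrow_tail_def arrow_head_def)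
  qed
qed

lemma arrow_exists:
  assumes "i < n" "j < n" "i \<noteq> j" "i \<noteq> n - Suc j" "i \<noteq> n - Suc i" "j \<noteq> n - Suc j"
  shows "\<exists>a\<in>arrows l. i = arrow_tail n a \<and> j = arrow_head n a \<or>
    i = arrow_head n a \<and> j = arrow_tail n a"
proof -
  let ?u = "vertex n i" and ?v = "vertex n j"
  have uv: "?u \<in> {1..l}" "?v \<in> {1..l}" "?u \<noteq> ?v"
    using assms vertex_range vertex_eq_iff by auto
  have lo: "i < l \<and> i = ?u - 1 \<or> l \<le> i \<and> i = n - ?u" "j < l \<and> j = ?v - 1 \<or> l \<le> j \<and> j = n - ?v"
    using assms n by (auto simp: vertex_def min_def)
  \<comment> \<open>\<open>d\<close> is the dot, and \<open>s\<close> tells whether \<open>i\<close>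
    must be the tail. The tail of a dotted arrow is the smaller vertex in the first half and the
    larger one in the second; the tail of a plain arrow is the index in the first half.\<close>
  define d where "d \<longleftrightarrow> (i < l \<longleftrightarrow> j < l)"
  define s where "s \<longleftrightarrow> (if d then (i < l \<longleftrightarrow> ?u < ?v) else i < l)"
  let ?a = "if s then Arrow d ?u ?v else Arrow d ?v ?u"
  have "?a \<in> arrows l" using uv by (simp add: arrows_def)
  moreover have "i = arrow_tail n ?a \<and> j = arrow_head n ?a \<or>
      i = arrow_head n ?a \<and> j = arrow_tail n ?a"
    using lo uv(3) unfolding arrow_tail_def arrow_head_def s_def d_def by (auto simp: not_less)
  ultimately show ?thesis by blast
qed

lemma bij_betw_patterns_matchings:
  "bij_betw (pattern_rel n) (Oolp l) {R. isotropic_matching n R}"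
  unfolding bij_betw_def
proof
  have mem: "a \<in> P \<longleftrightarrow> (arrow_tail n a, arrow_head n a) \<in> pattern_rel n P"
    if "P \<subseteq> arrows l" "a \<in> arrows l" for a P
    using arrow_inj[OF that(2)] that(1) unfolding pattern_rel_def by blast
  show "inj_on (pattern_rel n) (Oolp l)"
  proof (rule inj_onI)
    fix P Q assume "P \<in> Oolp l" "Q \<in> Oolp l" "pattern_rel n P = pattern_rel n Q"
    then show "P = Q" using mem[of P] mem[of Q] unfolding Oolp_iff by blast
  qed
  have "isotropic_matching n (pattern_rel n P)" if P: "P \<in> Oolp l" for P
  proof -
    have PA: "P \<subseteq> arrows l" and uniq: "\<And>v a b. a \<in> P \<Longrightarrow> b \<in> P \<Longrightarrow> touches a v \<Longrightarrow> touches b v \<Longrightarrow> a = b"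
      using P unfolding Oolp_iff by blast+
    have ends: "i < n \<and> j < n \<and> (\<exists>a\<in>P. (i = arrow_tail n a \<and> j = arrow_head n a \<or>
        i = arrow_head n a \<and> j = arrow_tail n a) \<and> touches a (vertex n i) \<and> vertex n i \<noteq> vertex n j)"
      if ij: "(i, j) \<in> pattern_rel n P" for i j
    proof -
      obtain a where a: "a \<in> P" "i = arrow_tail n a \<and> j = arrow_head n a \<or> i = arrow_head n a \<and> j = arrow_tail n a"
        using ij unfolding pattern_rel_def by blast
      have A: "a \<in> arrows l" using a PA by blast
      then have "source a \<noteq> target a" by (simp add: arrows_def)
      then show ?thesis
        using a arrow_ends[OF A] unfolding touches_def by (intro conjI bexI[of _ a]) auto
    qed
    \<comment> \<open>Both pairs come from the one arrow at this vertex. Its two ends have different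
      vertices, so both pairs list it from the same end.\<close>
    have same: "j = k \<and> i = i'" if ij: "(i, j) \<in> pattern_rel n P" "(i', k) \<in> pattern_rel n P"
      and v: "vertex n i = vertex n i'" for i j i' k
    proof -
      obtain a b where a: "a \<in> P" "touches a (vertex n i)" "vertex n i \<noteq> vertex n j"
          "i = arrow_tail n a \<and> j = arrow_head n a \<or> i = arrow_head n a \<and> j = arrow_tail n a"
        and b: "b \<in> P" "touches b (vertex n i')"
          "i' = arrow_tail n b \<and> k = arrow_head n b \<or> i' = arrow_head n b \<and> k = arrow_tail n b"
        using ends[OF ij(1)] ends[OF ij(2)] by metis
      have "a = b" using uniq a b v by metis
      then show ?thesis using a(3,4) b(3) v by metis
    qed
    show ?thesis
      unfolding isotropic_matching_def
    proof (intro conjI allI impI)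
      show "pattern_rel n P \<subseteq> {..<n} \<times> {..<n}" using ends by auto
      show "sym (pattern_rel n P)" unfolding sym_def pattern_rel_def by blast
      show "(i, i) \<notin> pattern_rel n P" for i using ends[of i i] by auto
      show "j = k" if "(i, j) \<in> pattern_rel n P" "(i, k) \<in> pattern_rel n P" for i j k
        using same[OF that] by simp
      show "(n - Suc i, k) \<notin> pattern_rel n P" if ij: "(i, j) \<in> pattern_rel n P" for i j k
      proof
        assume k: "(n - Suc i, k) \<in> pattern_rel n P"
        have i: "i < n" using ends[OF ij] by simp
        then have "vertex n i = vertex n (n - Suc i)" using vertex_eq_iff[of i "n - Suc i"] by auto
        then have "i = n - Suc i" using same[OF ij k] by simp
        \<comment> \<open>An index equal to its opposite would have the vertex
          \<open>l + 1\<close>.\<close>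
        moreover have "vertex n i \<in> {1..l}"
          using ends[OF ij] PA unfolding touches_def arrows_def by fastforce
        ultimately show False using n i by (auto simp: vertex_def)
      qed
    qed
  qed
  moreover have "R \<in> pattern_rel n ` Oolp l" if R: "isotropic_matching n R" for R
  proof
    note D = isotropic_matchingD[OF R]
    \<comment> \<open>\<open>R\<close> is symmetric, so testing one order of the two indices of an
      arrow is enough.\<close>
    define P where "P = {a \<in> arrows l. (arrow_tail n a, arrow_head n a) \<in> R}"
    have sub: "P \<subseteq> arrows l" by (auto simp: P_def)
    show "R = pattern_rel n P"
    proof
      show "pattern_rel n P \<subseteq> R" unfolding pattern_rel_def P_def using D(3) by auto
      show "R \<subseteq> pattern_rel n P"
      proof safe
        fix i j assume ij: "(i, j) \<in> R"
        note ji = D(3)[OF ij]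
        have "i \<noteq> j" "i \<noteq> n - Suc j" "i \<noteq> n - Suc i" "j \<noteq> n - Suc j"
          using D(4) D(6)[OF ij] D(6)[OF ji] ij ji by metis+
        then obtain a where "a \<in> arrows l"
          "i = arrow_tail n a \<and> j = arrow_head n a \<or> i = arrow_head n a \<and> j = arrow_tail n a"
          using arrow_exists D(1,2)[OF ij] by metis
        then show "(i, j) \<in> pattern_rel n P" using ij ji unfolding P_def pattern_rel_def by auto
      qed
    qed
    have "a = b" if a: "a \<in> P" "touches a v" and b: "b \<in> P" "touches b v" for a b v
    proof -
      have *: "\<exists>i j. (i, j) \<in> R \<and> vertex n i = v \<and> (i = arrow_tail n a \<and> j = arrow_head n a \<or>
          i = arrow_head n a \<and> j = arrow_tail n a)" if "a \<in> P" "touches a v" for a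
        using that D(3) arrow_ends(3,4)[of a] unfolding P_def touches_def by blast
      obtain i j where ij: "(i, j) \<in> R" "vertex n i = v"
        "i = arrow_tail n a \<and> j = arrow_head n a \<or> i = arrow_head n a \<and> j = arrow_tail n a"
        using *[OF a] by blast
      obtain i' j' where ij': "(i', j') \<in> R" "vertex n i' = v"
        "i' = arrow_tail n b \<and> j' = arrow_head n b \<or> i' = arrow_head n b \<and> j' = arrow_tail n b"
        using *[OF b] by blast
      have "i = i' \<or> i' = n - Suc i"
        using vertex_eq_iff[of i' i] D(1)[OF ij(1)] D(1)[OF ij'(1)] ij(2) ij'(2) by auto
      then have "i = i'" using D(6)[OF ij(1)] ij'(1) by blast
      then have "j = j'" using D(5) ij(1) ij'(1) by blast
      then show "a = b" using \<open>i = i'\<close> ij(3) ij'(3) a b sub by (intro arrow_inj) auto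
    qed
    then show "P \<in> Oolp l" using sub unfolding Oolp_iff by blast
  qed
  ultimately show "pattern_rel n ` Oolp l = {R. isotropic_matching n R}" by blast
qed

end

theorem theorem6p9:
  fixes l n :: nat
  assumes "l \<ge> 1" and "n \<in> {2 * l, 2 * l + 1}"
  shows "\<exists>f. bij_betw f (orbits (borel_group n) (nilpotent2 n) (conjugation n)) (Oolp l)"
  using bij_betw_inv_into[OF bij_betw_trans[OF bij_betw_patterns_matchings[OF assms(2)]
      bij_betw_matchings_orbits]] by blast

end
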